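(* Let $\lambda$ be an even partition. Then the polynomial subspace $\mathcal{U}_\lambda=\operatorname{span}\{H_{\lambda,i} : i\in\mathbb{N}_0\setminus K_\lambda\}$ is dense in the Hilbert space $\mathrm{L}^2(\mathbb{R},W_\lambda)$, where $W_\lambda(x)=\dfrac{e^{-x^2}}{H_\lambda(x)^2}\,dx$, $x\in\mathbb{R}$.
   Context: $\mathbb{N}_0$ denotes the non-negative integers. A partition $\lambda$ of length $\ell$ is a sequence of integers $\lambda_1\ge\lambda_2\ge\cdots\ge\lambda_\ell>0$ with $\lambda_i=0$ for $i>\ell$. It is an even partition if $\ell=2m$ and $\lambda_{2i-1}=\lambda_{2i}$ for $i=1,\dots,m$. Put $k_i=\lambda_i+\ell-i$ for $i=1,\dots,\ell$ and $K_\lambda=\{k_1,\dots,k_\ell\}$ (so $k_1>\cdots>k_\ell>0$). Let $H_n(x)=(-1)^n e^{x^2}\left(\frac{d}{dx}\right)^n e^{-x^2}$, $n\in\mathbb{N}_0$, be the classical Hermite polynomials. With $\operatorname{Wr}[f_1,\dots,f_n]=\det\big(f_j^{(i-1)}\big)_{i,j=1}^n$ the Wronskian determinant (equal to $1$ for the empty list), define the polynomials $$H_\lambda=\operatorname{Wr}[H_{k_\ell},\dots,H_{k_1}],\qquad H_{\lambda,i}=\operatorname{Wr}[H_{k_\ell},\dots,H_{k_1},H_i],\quad i\in\mathbb{N}_0\setminus K_\lambda.$$ The span is taken over $\mathbb{C}$ and the $\mathrm{L}^2$ space consists of complex-valued functions. It is a known fact that $H_\lambda$ has no real zeros if and only if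 $\lambda$ is an even partition, so for even $\lambda$ the weight $W_\lambda$ is regular on $\mathbb{R}$ and has finite moments of all orders. *)

theory Defs
  imports
    "HOL-Analysis.Analysis"
    "HOL-Library.Function_Algebras"
    "Jordan_Normal_Form.Determinant"
begin

text \<open>
  Partitions are lists of their nonzero parts, so the part written \<open>\<lambda>\<^sub>i\<close> with \<open>i = 1, \<dots>, \<ell>\<close> is
  \<open>l ! (i - 1)\<close>, and the empty partition is \<open>[]\<close>.
\<close>

definition is_partition :: "nat list \<Rightarrow> bool" where
  "is_partition l \<longleftrightarrow> sorted_wrt (\<ge>) l \<and> (\<forall>p\<in>set l. 0 < p)"

definition even_partition :: "nat list \<Rightarrow> bool" where
  "even_partition l \<longleftrightarrow>
     is_partition l \<and> (\<exists>m. length l = 2 * m \<and> (\<forall>i<m. l ! (2 * i) = l ! (2 * i + 1)))"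

text \<open>The list \<open>[k\<^sub>1, \<dots>, k\<^sub>\<ell>]\<close> with \<open>k\<^sub>i = \<lambda>\<^sub>i + \<ell> - i\<close>; it is strictly decreasing.\<close>

definition part_indices :: "nat list \<Rightarrow> nat list" where
  "part_indices l = map (\<lambda>i. l ! i + (length l - (i + 1))) [0..<length l]"

abbreviation K_set :: "nat list \<Rightarrow> nat set" where
  "K_set l \<equiv> set (part_indices l)"

definition hermite :: "nat \<Rightarrow> real \<Rightarrow> real" where
  "hermite n x = (-1) ^ n * exp (x\<^sup>2) * (deriv ^^ n) (\<lambda>t. exp (- t\<^sup>2)) x"

text \<open>The empty list gives the determinant of the \<open>0 \<times> 0\<close> matrix, which is \<open>1\<close>.\<close>

definition wronskian :: "(real \<Rightarrow> real) list \<Rightarrow> real \<Rightarrow> real" where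
  "wronskian fs x =
     Determinant.det (Matrix.mat (length fs) (length fs) (\<lambda>(i, j). (deriv ^^ i) (fs ! j) x))"

definition hermite_part :: "nat list \<Rightarrow> real \<Rightarrow> real" where
  "hermite_part l = wronskian (map hermite (rev (part_indices l)))"

definition exc_hermite :: "nat list \<Rightarrow> nat \<Rightarrow> real \<Rightarrow> real" where
  "exc_hermite l i = wronskian (map hermite (rev (part_indices l) @ [i]))"

definition exc_weight :: "nat list \<Rightarrow> real measure" where
  "exc_weight l = density lborel (\<lambda>x. ennreal (exp (- x\<^sup>2) / (hermite_part l x)\<^sup>2))"

definition fun_scale :: "complex \<Rightarrow> (real \<Rightarrow> complex) \<Rightarrow> real \<Rightarrow> complex" where
  "fun_scale c f = (\<lambda>x. c * f x)"

interpretation complex_fun: vector_space fun_scale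
  by standard (auto simp: fun_scale_def fun_eq_iff algebra_simps)

definition exc_space :: "nat list \<Rightarrow> (real \<Rightarrow> complex) set" where
  "exc_space l =
     complex_fun.span {\<lambda>x. complex_of_real (exc_hermite l i x) | i. i \<notin> K_set l}"

text \<open>
  \<open>L\<^sup>2(M)\<close> is represented by square-integrable functions rather than their almost-everywhere
  classes; \<open>norm_L2\<close> is constant on these classes, so density is the same in both readings.
  The inclusion \<open>S \<subseteq> space_L2 M\<close> in \<open>dense_L2\<close> also guarantees that the integral defining
  \<open>norm_L2 M (f - g)\<close> there is a convergent one.
\<close>

definition space_L2 :: "'a measure \<Rightarrow> ('a \<Rightarrow> complex) set" where
  "space_L2 M = {f. f \<in> borel_measurable M \<and> integrable M (\<lambda>x. (cmod (f x))\<^sup>2)}"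

definition norm_L2 :: "'a measure \<Rightarrow> ('a \<Rightarrow> complex) \<Rightarrow> real" where
  "norm_L2 M f = sqrt (\<integral>x. (cmod (f x))\<^sup>2 \<partial>M)"

definition dense_L2 :: "'a measure \<Rightarrow> ('a \<Rightarrow> complex) set \<Rightarrow> bool" where
  "dense_L2 M S \<longleftrightarrow>
     S \<subseteq> space_L2 M \<and> (\<forall>f\<in>space_L2 M. \<forall>e>0. \<exists>g\<in>S. norm_L2 M (\<lambda>x. f x - g x) < e)"

end

theory Submission
  imports
    Defs
    "HOL-Probability.Distributions"
    "HOL-Computational_Algebra.Fundamental_Theorem_Algebra"
begin

text \<open>
  Write \<open>H\<close> for the Wronskian \<open>H\<^sub>\<lambda>\<close> and \<open>w(x) = e\<^bsup>-x\<^sup>2\<^esup>\<close>. The exceptional polynomials are the values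
  on Hermite polynomials of the linear differential operator \<open>T y = Wr[\<dots>, y]\<close>, which kills the
  \<open>H\<^sub>k\<close> with \<open>k \<in> K\<^sub>\<lambda>\<close>; so the space that they span is the image under \<open>T\<close> of all polynomials. The
  leading coefficient of \<open>T\<close> is \<open>H\<close>, and variation of parameters solves \<open>T y = H\<^sup>2 q\<close> with a
  polynomial \<open>y\<close> for every polynomial \<open>q\<close>: the right-hand side \<open>H\<^sup>2 q\<close> cancels all denominators, so
  only antiderivatives of polynomials have to be taken (\<open>wr_poly_range\<close>). The span therefore contains
  the ideal generated by \<open>H\<^sup>2\<close>. The map \<open>f \<mapsto> f / H\<^sup>2\<close> is an isometry from \<open>L\<^sup>2(w / H\<^sup>2)\<close> onto
  \<open>L\<^sup>2(H\<^sup>2 w)\<close> and sends this ideal to the set of all polynomials; these are dense because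
  \<open>H\<^sup>2 w\<close> has exponential moments (\<open>poly_approx_L2\<close>).

  All this presupposes that \<open>H\<close> has no real zero, the theorem of Krein and Adler
  (\<open>hermite_part_no_zeros\<close>). A zero \<open>x\<^sub>0\<close> would give a nontrivial combination \<open>f\<close> of the \<open>H\<^sub>k\<close>,
  \<open>k \<in> K\<^sub>\<lambda>\<close>, that vanishes at \<open>x\<^sub>0\<close> to order \<open>\<ell> = |K\<^sub>\<lambda>|\<close>. For an even partition \<open>K\<^sub>\<lambda>\<close> is a disjoint
  union of pairs \<open>{a, a + 1}\<close>. Put \<open>R(t) = \<Prod>(t - a)\<close> and \<open>S(t) = \<Prod>(t - a - 1)\<close>, products over these
  pairs; then \<open>R(n) S(n) \<ge> 0\<close> for all natural \<open>n\<close>, with equality exactly on \<open>K\<^sub>\<lambda>\<close>. Let \<open>A\<close> be the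
  symmetric operator with \<open>A H\<^sub>n = n H\<^sub>n\<close> and let \<open>u\<close> be \<open>f\<close> on \<open>(x\<^sub>0, \<infinity>)\<close> and \<open>0\<close> elsewhere. The zero of
  order \<open>\<ell>\<close> is exactly what makes all boundary terms at \<open>x\<^sub>0\<close> disappear, so that
  \<open>\<langle>R(A) u, S(A) u\<rangle> = \<langle>u, R(A) S(A) f\<rangle> = 0\<close>, while Parseval's formula expands the left-hand side into
  a sum of terms \<open>R(n) S(n) \<langle>u, H\<^sub>n\<rangle>\<^sup>2 / \<parallel>H\<^sub>n\<parallel>\<^sup>2 \<ge> 0\<close>. Hence \<open>\<langle>u, H\<^sub>n\<rangle> = 0\<close> for \<open>n \<notin> K\<^sub>\<lambda>\<close>, so \<open>u\<close> agrees
  almost everywhere with a polynomial, which is impossible unless \<open>f = 0\<close>.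
\<close>

section \<open>Density of polynomials under exponential moments\<close>

locale exponential_moments =
  fixes M :: "real measure"
  assumes sets_M [measurable_cong, simp]: "sets M = sets borel"
    and AE_M: "\<And>P. AE x in lborel. P x \<Longrightarrow> AE x in M. P x"
    and integrable_exp: "\<And>c. integrable M (\<lambda>x. exp (c * \<bar>x\<bar>))"
begin

lemma space_M [simp]: "space M = UNIV"
  using sets_eq_imp_space_eq[OF sets_M] by simp

text \<open>
  Membership in the \<open>L\<^sup>2(M)\<close>-closure of the polynomials. Requiring the difference to be
  square-integrable is essential, since a divergent Bochner integral has value \<open>0\<close>.
\<close>
definition poly_approx :: "(real \<Rightarrow> real) \<Rightarrow> bool" where
  "poly_approx f \<longleftrightarrow> f \<in> borel_measurable borel \<and>
     (\<forall>e>0. \<exists>p. integrable M (\<lambda>x. (f x - poly p x)\<^sup>2) \<and> (\<integral>x. (f x - poly p x)\<^sup>2 \<partial>M) < e)"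

lemma poly_approx_poly: "poly_approx (poly p)"
proof -
  have "poly p \<in> borel_measurable borel"
    by (intro borel_measurable_continuous_onI continuous_intros)
  moreover have "\<exists>q. integrable M (\<lambda>x. (poly p x - poly q x)\<^sup>2) \<and>
      (\<integral>x. (poly p x - poly q x)\<^sup>2 \<partial>M) < e" if "e > 0" for e
    using that by (intro exI[of _ p]) simp
  ultimately show ?thesis by (simp add: poly_approx_def)
qed

text \<open>
  Every enlargement of the known closure below is an instance of this one use of dominated
  convergence: partial sums of power series, functions periodic in \<open>x\<close>, continuous functions,
  truncations.
\<close>
lemma poly_approx_limit:
  assumes g: "\<And>n. poly_approx (g n)"
    and h [measurable]: "h \<in> borel_measurable borel"
    and lim: "AE x in M. (\<lambda>n. g n x) \<longlonglongrightarrow> h x"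
    and bound: "\<And>n x. \<bar>g n x\<bar> \<le> G x" "\<And>x. \<bar>h x\<bar> \<le> G x"
    and G: "integrable M (\<lambda>x. (G x)\<^sup>2)"
  shows "poly_approx h"
proof -
  have gm [measurable]: "g n \<in> borel_measurable borel" for n
    using g by (auto simp: poly_approx_def)
  have dom: "(h x - g n x)\<^sup>2 \<le> 4 * (G x)\<^sup>2" for n x
  proof -
    have "\<bar>h x - g n x\<bar> \<le> 2 * G x" using bound(1)[of n x] bound(2)[of x] by linarith
    hence "\<bar>h x - g n x\<bar>\<^sup>2 \<le> (2 * G x)\<^sup>2" by (intro power_mono) auto
    thus ?thesis by (simp add: power_mult_distrib)
  qed
  have G4: "integrable M (\<lambda>x. 4 * (G x)\<^sup>2)" using G by simp
  have int: "integrable M (\<lambda>x. (h x - g n x)\<^sup>2)" for n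
    by (rule Bochner_Integration.integrable_bound[OF G4]) (use dom[of _ n] in auto)
  have "(\<lambda>n. \<integral>x. (h x - g n x)\<^sup>2 \<partial>M) \<longlonglongrightarrow> (\<integral>x. 0 \<partial>M)"
  proof (rule integral_dominated_convergence[OF _ _ G4])
    show "AE x in M. (\<lambda>n. (h x - g n x)\<^sup>2) \<longlonglongrightarrow> 0"
      using lim
    proof eventually_elim
      case (elim x)
      have "(\<lambda>n. (h x - g n x)\<^sup>2) \<longlonglongrightarrow> (h x - h x)\<^sup>2" by (intro tendsto_intros elim)
      thus ?case by simp
    qed
    show "AE x in M. norm ((h x - g n x)\<^sup>2) \<le> 4 * (G x)\<^sup>2" for n using dom by simp
  qed auto
  hence lim0: "(\<lambda>n. \<integral>x. (h x - g n x)\<^sup>2 \<partial>M) \<longlonglongrightarrow> 0" by simp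
  show ?thesis unfolding poly_approx_def
  proof (intro conjI allI impI h)
    fix e :: real assume e: "e > 0"
    have "\<forall>\<^sub>F n in sequentially. (\<integral>x. (h x - g n x)\<^sup>2 \<partial>M) < e / 4"
      by (rule order_tendstoD(2)[OF lim0]) (use e in simp)
    then obtain n where n: "(\<integral>x. (h x - g n x)\<^sup>2 \<partial>M) < e / 4"
      by (auto simp: eventually_sequentially)
    have "e / 4 > 0" using e by simp
    then obtain p where p: "integrable M (\<lambda>x. (g n x - poly p x)\<^sup>2)"
        "(\<integral>x. (g n x - poly p x)\<^sup>2 \<partial>M) < e / 4"
      using g[of n] unfolding poly_approx_def by blast
    have pm [measurable]: "poly p \<in> borel_measurable borel"
      by (intro borel_measurable_continuous_onI continuous_intros)
    have le: "(h x - poly p x)\<^sup>2 \<le> 2 * (h x - g n x)\<^sup>2 + 2 * (g n x - poly p x)\<^sup>2" for x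
      using zero_le_power2[of "(h x - g n x) - (g n x - poly p x)"]
      by (simp add: power2_eq_square algebra_simps)
    have i2: "integrable M (\<lambda>x. 2 * (h x - g n x)\<^sup>2 + 2 * (g n x - poly p x)\<^sup>2)"
      using int[of n] p(1) by simp
    have i: "integrable M (\<lambda>x. (h x - poly p x)\<^sup>2)"
      by (rule Bochner_Integration.integrable_bound[OF i2]) (use le in auto)
    have "(\<integral>x. (h x - poly p x)\<^sup>2 \<partial>M) \<le> (\<integral>x. 2 * (h x - g n x)\<^sup>2 + 2 * (g n x - poly p x)\<^sup>2 \<partial>M)"
      by (rule integral_mono[OF i i2 le])
    also have "\<dots> = 2 * (\<integral>x. (h x - g n x)\<^sup>2 \<partial>M) + 2 * (\<integral>x. (g n x - poly p x)\<^sup>2 \<partial>M)"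
      using int[of n] p(1) by simp
    also have "\<dots> < e" using n p(2) by linarith
    finally show "\<exists>p. integrable M (\<lambda>x. (h x - poly p x)\<^sup>2) \<and> (\<integral>x. (h x - poly p x)\<^sup>2 \<partial>M) < e"
      using i by blast
  qed
qed

end

text \<open>
  Entire functions of exponential type, described by their Taylor coefficients so that partial
  sums are dominated by \<open>C e\<^bsup>c|x|\<^esup>\<close>, which is square-integrable under the moment condition.
\<close>
definition exp_type :: "(real \<Rightarrow> real) \<Rightarrow> bool" where
  "exp_type g \<longleftrightarrow> (\<exists>a C c. C \<ge> 0 \<and> c \<ge> 0 \<and> (\<forall>n. \<bar>a n\<bar> \<le> C * c ^ n / fact n) \<and>
     (\<forall>x. (\<lambda>n. a n * x ^ n) sums g x))"

lemma exp_type_const: "exp_type (\<lambda>_. k)"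
proof -
  let ?a = "\<lambda>n::nat. if n = 0 then k else 0"
  have "(\<lambda>n. ?a n * x ^ n) sums k" for x :: real
    using sums_single[of 0 "\<lambda>n. k"] by (simp add: if_distrib[of "\<lambda>u. u * _"] cong: if_cong)
  moreover have "\<bar>?a n\<bar> \<le> \<bar>k\<bar> * 1 ^ n / fact n" for n by auto
  ultimately show ?thesis unfolding exp_type_def
    by (intro exI[of _ ?a] exI[of _ "\<bar>k\<bar>"] exI[of _ 1]) auto
qed

lemma exp_type_sin: "exp_type (\<lambda>x. sin (w * x))"
proof -
  let ?a = "\<lambda>n. sin_coeff n * w ^ n"
  have "(\<lambda>n. ?a n * x ^ n) sums sin (w * x)" for x
    using sin_converges[of "w * x"] by (simp add: power_mult_distrib mult.assoc)
  moreover have "\<bar>?a n\<bar> \<le> 1 * \<bar>w\<bar> ^ n / fact n" for n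
    by (auto simp: sin_coeff_def abs_mult power_abs divide_simps)
  ultimately show ?thesis unfolding exp_type_def
    by (intro exI[of _ ?a] exI[of _ 1] exI[of _ "\<bar>w\<bar>"]) auto
qed

lemma exp_type_add:
  assumes "exp_type f" "exp_type g"
  shows "exp_type (\<lambda>x. f x + g x)"
proof -
  obtain a C c where a: "C \<ge> 0" "c \<ge> 0" "\<And>n. \<bar>a n\<bar> \<le> C * c ^ n / fact n" "\<And>x. (\<lambda>n. a n * x ^ n) sums f x"
    using assms(1) by (auto simp: exp_type_def)
  obtain b D d where b: "D \<ge> 0" "d \<ge> 0" "\<And>n. \<bar>b n\<bar> \<le> D * d ^ n / fact n" "\<And>x. (\<lambda>n. b n * x ^ n) sums g x"
    using assms(2) by (auto simp: exp_type_def)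
  have "\<bar>a n + b n\<bar> \<le> (C + D) * (max c d) ^ n / fact n" for n
  proof -
    have "C * c ^ n / fact n \<le> C * (max c d) ^ n / fact n"
      using a b by (intro divide_right_mono mult_left_mono power_mono) auto
    moreover have "D * d ^ n / fact n \<le> D * (max c d) ^ n / fact n"
      using a b by (intro divide_right_mono mult_left_mono power_mono) auto
    ultimately show ?thesis using a(3)[of n] b(3)[of n] by (simp add: algebra_simps add_divide_distrib)
  qed
  moreover have "(\<lambda>n. (a n + b n) * x ^ n) sums (f x + g x)" for x
    using sums_add[OF a(4) b(4)] by (simp add: algebra_simps)
  ultimately show ?thesis unfolding exp_type_def using a(1,2) b(1,2)
    by (intro exI[of _ "\<lambda>n. a n + b n"] exI[of _ "C + D"] exI[of _ "max c d"]) auto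
qed

text \<open>
  The Cauchy product of the two series satisfies the coefficient bound with \<open>c + d\<close> in place of
  \<open>c\<close> and \<open>d\<close>, by the binomial theorem.
\<close>
lemma exp_type_mult:
  assumes "exp_type f" "exp_type g"
  shows "exp_type (\<lambda>x. f x * g x)"
proof -
  obtain a C c where a: "C \<ge> 0" "c \<ge> 0" "\<And>n. \<bar>a n\<bar> \<le> C * c ^ n / fact n" "\<And>x. (\<lambda>n. a n * x ^ n) sums f x"
    using assms(1) by (auto simp: exp_type_def)
  obtain b D d where b: "D \<ge> 0" "d \<ge> 0" "\<And>n. \<bar>b n\<bar> \<le> D * d ^ n / fact n" "\<And>x. (\<lambda>n. b n * x ^ n) sums g x"
    using assms(2) by (auto simp: exp_type_def)
  let ?e = "\<lambda>n. \<Sum>i\<le>n. a i * b (n - i)"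
  have summ: "summable (\<lambda>n. norm (u n * x ^ n))"
    if "\<And>n. \<bar>u n\<bar> \<le> K * k ^ n / fact n" "K \<ge> 0" "k \<ge> 0" for u :: "nat \<Rightarrow> real" and K k x
  proof (rule summable_comparison_test'[of "\<lambda>n. K * ((k * \<bar>x\<bar>) ^ n /\<^sub>R fact n)" 0])
    show "summable (\<lambda>n. K * ((k * \<bar>x\<bar>) ^ n /\<^sub>R fact n))"
      by (intro summable_mult summable_exp_generic)
    show "norm (norm (u n * x ^ n)) \<le> K * ((k * \<bar>x\<bar>) ^ n /\<^sub>R fact n)" for n
      using mult_right_mono[OF that(1)[of n], of "\<bar>x\<bar> ^ n"]
      by (simp add: abs_mult power_abs power_mult_distrib field_simps)
  qed
  have "(\<lambda>n. ?e n * x ^ n) sums (f x * g x)" for x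
  proof -
    have "(\<lambda>n. \<Sum>i\<le>n. (a i * x ^ i) * (b (n - i) * x ^ (n - i))) sums
        ((\<Sum>n. a n * x ^ n) * (\<Sum>n. b n * x ^ n))"
      by (rule Cauchy_product_sums) (use summ a b in auto)
    moreover have "(\<Sum>i\<le>n. (a i * x ^ i) * (b (n - i) * x ^ (n - i))) = ?e n * x ^ n" for n
      unfolding sum_distrib_right
      by (intro sum.cong refl) (simp add: power_add[symmetric] mult.assoc mult.left_commute)
    ultimately show ?thesis using a(4)[of x] b(4)[of x] by (simp add: sums_iff)
  qed
  moreover have "\<bar>?e n\<bar> \<le> (C * D) * (c + d) ^ n / fact n" for n
  proof -
    have "\<bar>?e n\<bar> \<le> (\<Sum>i\<le>n. \<bar>a i\<bar> * \<bar>b (n - i)\<bar>)"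
      using sum_abs[of "\<lambda>i. a i * b (n - i)" "{..n}"] by (simp add: abs_mult)
    also have "\<dots> \<le> (\<Sum>i\<le>n. (C * c ^ i / fact i) * (D * d ^ (n - i) / fact (n - i)))"
      using a b by (intro sum_mono mult_mono) auto
    also have "\<dots> = (\<Sum>i\<le>n. (C * D) / fact n * (of_nat (n choose i) * c ^ i * d ^ (n - i)))"
      by (intro sum.cong refl) (simp add: binomial_fact)
    also have "\<dots> = (C * D) * (c + d) ^ n / fact n"
      by (simp add: binomial_ring sum_distrib_left sum_divide_distrib)
    finally show ?thesis .
  qed
  ultimately show ?thesis unfolding exp_type_def using a(1,2) b(1,2)
    by (intro exI[of _ ?e] exI[of _ "C * D"] exI[of _ "c + d"]) auto
qed

lemma exp_type_compose_sin:
  assumes "real_polynomial_function P"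
  shows "exp_type (\<lambda>x. P (sin (w * x)))"
  using assms
proof (induction P rule: real_polynomial_function.induct)
  case (linear f)
  interpret bounded_linear f by fact
  have lin: "f s = f 1 * s" for s using scale[of s 1] by simp
  have "(\<lambda>x. f (sin (w * x))) = (\<lambda>x. f 1 * sin (w * x))"
    by (rule ext) (rule lin)
  thus ?case using exp_type_mult[OF exp_type_const[of "f 1"] exp_type_sin[of w]] by simp
qed (auto intro: exp_type_const exp_type_add exp_type_mult)

context exponential_moments
begin

lemma finite_M: "finite_measure M"
  using integrable_exp[of 0] by (intro finite_measureI) (auto simp: integrable_iff_bounded)

lemma poly_approx_exp_type:
  assumes "exp_type g"
  shows "poly_approx g"
proof -
  obtain a C c where a: "C \<ge> 0" "c \<ge> 0" "\<And>n. \<bar>a n\<bar> \<le> C * c ^ n / fact n" "\<And>x. (\<lambda>n. a n * x ^ n) sums g x"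
    using assms by (auto simp: exp_type_def)
  define s where "s = (\<lambda>n x. \<Sum>i<n. a i * x ^ i)"
  have s_poly: "s n = poly (\<Sum>i<n. monom (a i) i)" for n
    by (auto simp: s_def poly_sum poly_monom)
  have bound: "\<bar>s n x\<bar> \<le> C * exp (c * \<bar>x\<bar>)" for n x
  proof -
    have "\<bar>s n x\<bar> \<le> (\<Sum>i<n. \<bar>a i\<bar> * \<bar>x\<bar> ^ i)"
      using sum_abs[of "\<lambda>i. a i * x ^ i" "{..<n}"] by (simp add: s_def abs_mult power_abs)
    also have "\<dots> \<le> (\<Sum>i<n. C * ((c * \<bar>x\<bar>) ^ i /\<^sub>R fact i))"
    proof (intro sum_mono)
      fix i show "\<bar>a i\<bar> * \<bar>x\<bar> ^ i \<le> C * ((c * \<bar>x\<bar>) ^ i /\<^sub>R fact i)"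
        using mult_right_mono[OF a(3)[of i], of "\<bar>x\<bar> ^ i"] by (simp add: power_mult_distrib field_simps)
    qed
    also have "\<dots> = C * (\<Sum>i<n. (c * \<bar>x\<bar>) ^ i /\<^sub>R fact i)" by (simp add: sum_distrib_left)
    also have "\<dots> \<le> C * exp (c * \<bar>x\<bar>)"
    proof (intro mult_left_mono a)
      show "(\<Sum>i<n. (c * \<bar>x\<bar>) ^ i /\<^sub>R fact i) \<le> exp (c * \<bar>x\<bar>)"
        using sum_le_suminf[OF summable_exp_generic[of "c * \<bar>x\<bar>"], of "{..<n}"] a
        by (simp add: exp_def)
    qed
    finally show ?thesis .
  qed
  have lim: "(\<lambda>n. s n x) \<longlonglongrightarrow> g x" for x using a(4)[of x] by (simp add: sums_def s_def)
  have sm: "s n \<in> borel_measurable borel" for n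
    using poly_approx_poly[of "\<Sum>i<n. monom (a i) i"] unfolding s_poly poly_approx_def by blast
  show ?thesis
  proof (rule poly_approx_limit[where g = s and G = "\<lambda>x. C * exp (c * \<bar>x\<bar>)"])
    show "poly_approx (s n)" for n unfolding s_poly by (rule poly_approx_poly)
    show "g \<in> borel_measurable borel"
      by (rule borel_measurable_LIMSEQ_real[OF lim sm])
    show "AE x in M. (\<lambda>n. s n x) \<longlonglongrightarrow> g x" using lim by simp
    show "\<bar>g x\<bar> \<le> C * exp (c * \<bar>x\<bar>)" for x
      by (rule LIMSEQ_le_const2[OF tendsto_rabs[OF lim]]) (use bound in auto)
    have "(\<lambda>x. (C * exp (c * \<bar>x\<bar>))\<^sup>2) = (\<lambda>x. C\<^sup>2 * exp ((2 * c) * \<bar>x\<bar>))"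
      by (auto simp: power_mult_distrib exp_double[symmetric] mult.assoc)
    thus "integrable M (\<lambda>x. (C * exp (c * \<bar>x\<bar>))\<^sup>2)" using integrable_exp by simp
  qed (rule bound)
qed

text \<open>
  On \<open>[-R, R]\<close> the variable \<open>x\<close> is a continuous function of \<open>sin (\<pi> x / (2 R))\<close>, so the
  Weierstrass theorem on \<open>[-1, 1]\<close> gives polynomials in this sine that are close to \<open>h\<close> on
  \<open>[-R, R]\<close>. Outside this interval they stay bounded, because the sine never leaves \<open>[-1, 1]\<close>; this
  is what a polynomial in \<open>x\<close> itself could not achieve. Finally let \<open>R\<close> tend to infinity.
\<close>
lemma poly_approx_bounded_continuous:
  assumes cont: "continuous_on UNIV h" and B: "\<And>x. \<bar>h x\<bar> \<le> B"
  shows "poly_approx h"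
proof -
  define R where "R = (\<lambda>n. real (Suc n))"
  have R: "R n > 0" for n by (simp add: R_def)
  have "\<exists>P. real_polynomial_function P \<and>
      (\<forall>s\<in>{-1..1}. \<bar>h (2 * R n / pi * arcsin s) - P s\<bar> < 1 / R n)" for n
  proof -
    have c: "continuous_on {-1..1} (\<lambda>s. h (2 * R n / pi * arcsin s))"
      by (rule continuous_on_compose2[OF cont continuous_on_mult_left[OF continuous_on_arcsin']]) simp
    have "0 < 1 / R n" using R[of n] by simp
    with c show ?thesis
      by (rule Stone_Weierstrass_real_polynomial_function[OF compact_Icc]) auto
  qed
  then obtain P where P: "\<And>n. real_polynomial_function (P n)"
      "\<And>n s. s \<in> {-1..1} \<Longrightarrow> \<bar>h (2 * R n / pi * arcsin s) - P n s\<bar> < 1 / R n"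
    by metis
  define g where "g = (\<lambda>n x. P n (sin (pi / (2 * R n) * x)))"
  show ?thesis
  proof (rule poly_approx_limit[where g = g and G = "\<lambda>x. B + 1"])
    show "poly_approx (g n)" for n
      unfolding g_def by (rule poly_approx_exp_type exp_type_compose_sin P)+
    show "h \<in> borel_measurable borel" by (rule borel_measurable_continuous_onI[OF cont])
    show "AE x in M. (\<lambda>n. g n x) \<longlonglongrightarrow> h x"
    proof (rule AE_I2)
      fix x
      have ev: "\<forall>\<^sub>F n in sequentially. \<bar>g n x - h x\<bar> \<le> 1 / R n"
      proof -
        obtain N where N: "\<bar>x\<bar> \<le> real N" using real_arch_simple by blast
        have "\<bar>g n x - h x\<bar> \<le> 1 / R n" if "n \<ge> N" for n
        proof -
          have xn: "\<bar>x\<bar> \<le> R n" using N that by (simp add: R_def)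
          have "- (pi / 2) \<le> pi / (2 * R n) * x" "pi / (2 * R n) * x \<le> pi / 2"
            using mult_left_mono[of "- R n" x pi] mult_left_mono[of x "R n" pi] xn R[of n]
            by (auto simp: field_simps abs_le_iff)
          hence "arcsin (sin (pi / (2 * R n) * x)) = pi / (2 * R n) * x" by (rule arcsin_sin)
          hence "2 * R n / pi * arcsin (sin (pi / (2 * R n) * x)) = x"
            using R[of n] by simp
          thus ?thesis using P(2)[of "sin (pi / (2 * R n) * x)" n] by (auto simp: g_def)
        qed
        thus ?thesis by (auto simp: eventually_sequentially)
      qed
      have "(\<lambda>n. 1 / R n) \<longlonglongrightarrow> 0" unfolding R_def by (rule LIMSEQ_Suc[OF lim_1_over_n])
      hence "(\<lambda>n. g n x - h x) \<longlonglongrightarrow> 0"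
        by (rule Lim_null_comparison[rotated]) (use ev in simp)
      thus "(\<lambda>n. g n x) \<longlonglongrightarrow> h x" by (simp add: LIM_zero_iff)
    qed
    show "\<bar>g n x\<bar> \<le> B + 1" for n x
    proof -
      have "\<bar>h (2 * R n / pi * arcsin (sin (pi / (2 * R n) * x))) - g n x\<bar> < 1 / R n"
        unfolding g_def by (rule P) auto
      moreover have "1 / R n \<le> 1" by (simp add: R_def)
      ultimately show ?thesis
        using B[of "2 * R n / pi * arcsin (sin (pi / (2 * R n) * x))"] by linarith
    qed
    show "\<bar>h x\<bar> \<le> B + 1" for x using B[of x] by linarith
    show "integrable M (\<lambda>x. (B + 1)\<^sup>2)" using finite_M by (simp add: finite_measure.integrable_const)
  qed
qed

text \<open>
  A measurable function is an almost everywhere limit of continuous ones; clipping these at the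
  bound of \<open>f\<close> supplies the dominating constant.
\<close>
lemma poly_approx_bounded:
  assumes f [measurable]: "f \<in> borel_measurable borel" and B: "\<And>x. \<bar>f x\<bar> \<le> B"
  shows "poly_approx f"
proof -
  have "f \<in> borel_measurable lebesgue" using f by (simp add: measurable_completion)
  hence "f measurable_on UNIV" by (intro lebesgue_measurable_imp_measurable_on) auto
  then obtain N g where N: "negligible N" "\<And>n. continuous_on UNIV (g n)"
      "\<And>x. x \<notin> N \<Longrightarrow> (\<lambda>n. g n x) \<longlonglongrightarrow> f x"
    unfolding measurable_on_def by auto
  have B0: "B \<ge> 0" using B[of 0] by linarith
  define k where "k = (\<lambda>n x. max (- B) (min B (g n x)))"
  have kB: "\<bar>k n x\<bar> \<le> B" for n x using B0 by (auto simp: k_def)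
  show ?thesis
  proof (rule poly_approx_limit[where g = k and G = "\<lambda>x. B"])
    show "poly_approx (k n)" for n
      by (rule poly_approx_bounded_continuous[OF _ kB]) (auto simp: k_def intro!: continuous_intros N)
    have "AE x in lebesgue. x \<notin> N"
      using N(1) by (intro AE_not_in) (simp add: negligible_iff_null_sets)
    hence "AE x in lborel. x \<notin> N" by (simp add: AE_completion_iff)
    hence "AE x in M. x \<notin> N" by (rule AE_M)
    thus "AE x in M. (\<lambda>n. k n x) \<longlonglongrightarrow> f x"
    proof eventually_elim
      case (elim x)
      have "(\<lambda>n. k n x) \<longlonglongrightarrow> max (- B) (min B (f x))"
        unfolding k_def by (intro tendsto_intros N elim)
      moreover have "max (- B) (min B (f x)) = f x" using B[of x] by (auto simp: abs_le_iff)
      ultimately show ?case by simp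
    qed
    show "integrable M (\<lambda>x. B\<^sup>2)" using finite_M by (simp add: finite_measure.integrable_const)
  qed (use kB B in auto)
qed

theorem poly_approx_L2:
  assumes f [measurable]: "f \<in> borel_measurable borel" and int: "integrable M (\<lambda>x. (f x)\<^sup>2)"
  shows "poly_approx f"
proof -
  define k where "k = (\<lambda>n x. max (- real n) (min (real n) (f x)))"
  show ?thesis
  proof (rule poly_approx_limit[where g = k and G = "\<lambda>x. \<bar>f x\<bar>"])
    show "poly_approx (k n)" for n
      by (rule poly_approx_bounded[where B = "real n"]) (auto simp: k_def)
    show "AE x in M. (\<lambda>n. k n x) \<longlonglongrightarrow> f x"
    proof (rule AE_I2)
      fix x
      obtain N where N: "\<bar>f x\<bar> \<le> real N" using real_arch_simple by blast
      have "k n x = f x" if "n \<ge> N" for n using N that by (auto simp: k_def)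
      thus "(\<lambda>n. k n x) \<longlonglongrightarrow> f x"
        by (intro tendsto_eventually) (auto simp: eventually_sequentially)
    qed
    show "\<bar>k n x\<bar> \<le> \<bar>f x\<bar>" for n x by (auto simp: k_def)
  qed (use int in auto)
qed

end

section \<open>Gaussian weights\<close>

lemma poly_exp_bound: "\<exists>C c. C \<ge> 0 \<and> c \<ge> 0 \<and> (\<forall>x. \<bar>poly p x\<bar> \<le> C * exp (c * \<bar>x\<bar>))" for p :: "real poly"
proof (induction p)
  case 0
  show ?case by (intro exI[of _ 0]) auto
next
  case (pCons a p)
  then obtain C c where C: "C \<ge> 0" "c \<ge> 0" "\<And>x. \<bar>poly p x\<bar> \<le> C * exp (c * \<bar>x\<bar>)" by auto
  have "\<bar>poly (pCons a p) x\<bar> \<le> (\<bar>a\<bar> + C) * exp ((c + 1) * \<bar>x\<bar>)" for x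
  proof -
    have x: "\<bar>x\<bar> \<le> exp \<bar>x\<bar>" using exp_ge_add_one_self[of "\<bar>x\<bar>"] by linarith
    have "\<bar>poly (pCons a p) x\<bar> \<le> \<bar>a\<bar> * 1 + \<bar>x\<bar> * \<bar>poly p x\<bar>" by (simp add: abs_mult[symmetric])
    also have "\<dots> \<le> \<bar>a\<bar> * exp ((c + 1) * \<bar>x\<bar>) + exp \<bar>x\<bar> * (C * exp (c * \<bar>x\<bar>))"
      using C x by (intro add_mono mult_mono) auto
    also have "\<dots> = (\<bar>a\<bar> + C) * exp ((c + 1) * \<bar>x\<bar>)" by (simp add: algebra_simps exp_add)
    finally show ?thesis .
  qed
  thus ?case using C by (intro exI[of _ "\<bar>a\<bar> + C"] exI[of _ "c + 1"]) auto
qed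

lemma poly_borel [measurable]: "poly p \<in> borel_measurable (borel :: real measure)" for p :: "real poly"
  by (intro borel_measurable_continuous_onI continuous_intros)

text \<open>
  Completing the square, \<open>c |x| \<le> c\<^sup>2/2 + x\<^sup>2/2\<close>, leaves half of the Gaussian exponent.
\<close>
lemma integrable_exp_gauss: "integrable lborel (\<lambda>x::real. exp (c * \<bar>x\<bar>) * exp (- x\<^sup>2))"
proof -
  have "integrable lborel (\<lambda>x. exp (c\<^sup>2 / 2) * (sqrt (2 * pi) * (normal_density 0 1 x * (x - 0) ^ 0)))"
    by (intro integrable_mult_right integrable_normal_moment) simp
  hence i: "integrable lborel (\<lambda>x. exp (c\<^sup>2 / 2) * exp (- x\<^sup>2 / 2))" by (simp add: normal_density_def)
  show ?thesis
  proof (rule Bochner_Integration.integrable_bound[OF i])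
    have "c * \<bar>x\<bar> + - x\<^sup>2 \<le> c\<^sup>2 / 2 + - x\<^sup>2 / 2" for x :: real
      using zero_le_power2[of "c - \<bar>x\<bar>"] by (simp add: power2_diff)
    thus "AE x in lborel. norm (exp (c * \<bar>x\<bar>) * exp (- x\<^sup>2)) \<le> norm (exp (c\<^sup>2 / 2) * exp (- x\<^sup>2 / 2))"
      by (simp add: exp_add[symmetric])
  qed simp
qed

lemma integrable_poly_exp_gauss:
  "integrable lborel (\<lambda>x::real. poly p x * exp (c * \<bar>x\<bar>) * exp (- x\<^sup>2))"
proof -
  obtain C d where C: "C \<ge> 0" "\<And>x. \<bar>poly p x\<bar> \<le> C * exp (d * \<bar>x\<bar>)"
    using poly_exp_bound[of p] by blast
  have i: "integrable lborel (\<lambda>x::real. C * (exp ((d + c) * \<bar>x\<bar>) * exp (- x\<^sup>2)))"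
    by (intro integrable_mult_right integrable_exp_gauss)
  show ?thesis
  proof (rule Bochner_Integration.integrable_bound[OF i])
    have "\<bar>poly p x\<bar> * (exp (c * \<bar>x\<bar>) * exp (- x\<^sup>2)) \<le> C * exp (d * \<bar>x\<bar>) * (exp (c * \<bar>x\<bar>) * exp (- x\<^sup>2))" for x
      by (intro mult_right_mono C) auto
    thus "AE x in lborel. norm (poly p x * exp (c * \<bar>x\<bar>) * exp (- x\<^sup>2)) \<le>
        norm (C * (exp ((d + c) * \<bar>x\<bar>) * exp (- x\<^sup>2)))"
      using C(1) by (simp add: abs_mult exp_add distrib_right mult.assoc)
  qed measurable
qed

text \<open>
  The weights \<open>q\<^sup>2 w\<close>: the case \<open>q = 1\<close> is the orthogonality measure of the Hermite polynomials,
  and \<open>q = H\<^sub>\<lambda>\<close> is the weight to which the density statement is transferred at the end.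
\<close>
definition poly_gauss :: "real poly \<Rightarrow> real measure" where
  "poly_gauss q = density lborel (\<lambda>x. ennreal ((poly q x)\<^sup>2 * exp (- x\<^sup>2)))"

lemma integrable_poly_gauss_iff:
  assumes [measurable]: "f \<in> borel_measurable borel"
  shows "integrable (poly_gauss q) f \<longleftrightarrow> integrable lborel (\<lambda>x. (poly q x)\<^sup>2 * exp (- x\<^sup>2) * f x)"
  unfolding poly_gauss_def by (subst integrable_density) auto

lemma integral_poly_gauss:
  assumes [measurable]: "f \<in> borel_measurable borel"
  shows "(\<integral>x. f x \<partial>poly_gauss q) = (\<integral>x. (poly q x)\<^sup>2 * exp (- x\<^sup>2) * f x \<partial>lborel)"
  unfolding poly_gauss_def by (subst integral_density) auto

lemma exponential_moments_poly_gauss: "exponential_moments (poly_gauss q)"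
proof
  show "sets (poly_gauss q) = sets borel" by (simp add: poly_gauss_def)
  show "AE x in poly_gauss q. P x" if "AE x in lborel. P x" for P
    unfolding poly_gauss_def using that by (subst AE_density) auto
  show "integrable (poly_gauss q) (\<lambda>x. exp (c * \<bar>x\<bar>))" for c
    using integrable_poly_exp_gauss[of "q * q" c]
    by (subst integrable_poly_gauss_iff) (auto simp: power2_eq_square ac_simps)
qed

abbreviation gauss :: "real measure" where "gauss \<equiv> poly_gauss 1"

interpretation gauss: exponential_moments gauss
  by (rule exponential_moments_poly_gauss)

definition L2 :: "real measure \<Rightarrow> (real \<Rightarrow> real) \<Rightarrow> bool" where
  "L2 M f \<longleftrightarrow> f \<in> borel_measurable borel \<and> integrable M (\<lambda>x. (f x)\<^sup>2)"

lemma (in exponential_moments) L2_mult_integrable: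
  assumes "L2 M f" "L2 M g"
  shows "integrable M (\<lambda>x. f x * g x)"
proof -
  have [measurable]: "f \<in> borel_measurable borel" "g \<in> borel_measurable borel"
    and i: "integrable M (\<lambda>x. (f x)\<^sup>2 + (g x)\<^sup>2)"
    using assms by (auto simp: L2_def)
  have "\<bar>f x * g x\<bar> \<le> (f x)\<^sup>2 + (g x)\<^sup>2" for x
    using zero_le_power2[of "f x + g x"] zero_le_power2[of "f x - g x"]
      zero_le_power2[of "f x"] zero_le_power2[of "g x"]
    unfolding power2_sum power2_diff abs_le_iff by linarith
  thus ?thesis by (intro Bochner_Integration.integrable_bound[OF i]) auto
qed

lemma (in exponential_moments) L2_diff:
  assumes "L2 M f" "L2 M g"
  shows "L2 M (\<lambda>x. f x - g x)"
proof -
  have "integrable M (\<lambda>x. (f x)\<^sup>2 + (g x)\<^sup>2 - 2 * (f x * g x))"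
    using assms L2_mult_integrable[OF assms] by (auto simp: L2_def)
  thus ?thesis using assms by (auto simp: L2_def power2_diff mult.assoc)
qed

lemma L2_poly: "L2 gauss (poly p)"
  using integrable_poly_exp_gauss[of "p * p" 0]
  by (auto simp: L2_def integrable_poly_gauss_iff power2_eq_square ac_simps)

definition right_part :: "real \<Rightarrow> real poly \<Rightarrow> real \<Rightarrow> real" where
  "right_part a p x = indicator {a<..} x * poly p x"

lemma right_part_borel [measurable]: "right_part a p \<in> borel_measurable borel"
  unfolding right_part_def[abs_def] by measurable

lemma L2_right_part: "L2 gauss (right_part a p)"
proof -
  have "integrable gauss (\<lambda>x. (poly p x)\<^sup>2)" using L2_poly by (simp add: L2_def)
  hence "integrable gauss (\<lambda>x. (right_part a p x)\<^sup>2)"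
    by (rule Bochner_Integration.integrable_bound) (auto simp: right_part_def power_mult_distrib indicator_def)
  thus ?thesis by (simp add: L2_def)
qed

lemma poly_gauss_tendsto_0:
  "((\<lambda>x. poly q x * exp (- x\<^sup>2)) \<longlongrightarrow> 0) at_infinity" for q :: "real poly"
proof -
  obtain C d where C: "C \<ge> 0" "\<And>x. \<bar>poly q x\<bar> \<le> C * exp (d * \<bar>x\<bar>)"
    using poly_exp_bound[of q] by blast
  have e: "((\<lambda>t::real. C * exp (d * t - t\<^sup>2)) \<longlongrightarrow> 0) at_top"
  proof -
    have "filterlim (\<lambda>t::real. - d + t) at_top at_top"
      by (intro filterlim_tendsto_add_at_top[OF tendsto_const] filterlim_ident)
    hence "filterlim (\<lambda>t::real. (- d + t) * t) at_top at_top"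
      by (rule filterlim_at_top_mult_at_top) (rule filterlim_ident)
    hence "filterlim (\<lambda>t::real. - ((- d + t) * t)) at_bot at_top"
      by (simp add: filterlim_uminus_at_bot)
    hence "filterlim (\<lambda>t::real. d * t - t\<^sup>2) at_bot at_top" by (simp add: algebra_simps power2_eq_square)
    hence "((\<lambda>t::real. exp (d * t - t\<^sup>2)) \<longlongrightarrow> 0) at_top" by (rule filterlim_compose[OF exp_at_bot])
    from tendsto_mult_left[OF this, of C] show ?thesis by simp
  qed
  have "filterlim (\<lambda>x::real. \<bar>x\<bar>) at_top at_infinity"
    using filterlim_norm_at_top[where 'a = real] by (simp only: real_norm_def[abs_def])
  from filterlim_compose[OF e this]
  have e2: "((\<lambda>x::real. C * exp (d * \<bar>x\<bar> - x\<^sup>2)) \<longlongrightarrow> 0) at_infinity" by simp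
  show ?thesis
  proof (rule Lim_null_comparison[OF _ e2], rule always_eventually, rule allI)
    fix x
    show "norm (poly q x * exp (- x\<^sup>2)) \<le> C * exp (d * \<bar>x\<bar> - x\<^sup>2)"
      using mult_right_mono[OF C(2)[of x], of "exp (- x\<^sup>2)"]
      by (simp add: abs_mult mult.assoc exp_add[symmetric])
  qed
qed

section \<open>Hermite polynomials and their differential operator\<close>

text \<open>
  The polynomial \<open>(q w)' / w\<close>.
\<close>
definition gauss_deriv :: "real poly \<Rightarrow> real poly" where
  "gauss_deriv q = pderiv q - [:0, 2:] * q"

lemma has_vector_derivative_poly_gauss:
  "((\<lambda>x. poly q x * exp (- x\<^sup>2)) has_vector_derivative poly (gauss_deriv q) x * exp (- x\<^sup>2)) (at x)"
proof -
  have "((\<lambda>x. poly q x * exp (- x\<^sup>2)) has_real_derivative poly (gauss_deriv q) x * exp (- x\<^sup>2)) (at x)"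
    unfolding gauss_deriv_def
    by (auto intro!: derivative_eq_intros simp: algebra_simps power2_eq_square)
  thus ?thesis by (simp add: has_real_derivative_iff_has_vector_derivative)
qed

lemma LBINT_gauss_deriv:
  assumes "a < \<infinity>"
    and A: "((\<lambda>t. poly q (real_of_ereal t) * exp (- (real_of_ereal t)\<^sup>2)) \<longlongrightarrow> A) (at_right a)"
  shows "(LBINT x=a..\<infinity>. poly (gauss_deriv q) x * exp (- x\<^sup>2)) = - A"
proof -
  have "(LBINT x=a..\<infinity>. poly (gauss_deriv q) x * exp (- x\<^sup>2)) = 0 - A"
  proof (rule interval_integral_FTC_integrable[where F = "\<lambda>x. poly q x * exp (- x\<^sup>2)"])
    show "set_integrable lborel (einterval a \<infinity>) (\<lambda>x. poly (gauss_deriv q) x * exp (- x\<^sup>2))"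
      using integrable_poly_exp_gauss[of "gauss_deriv q" 0]
      unfolding set_integrable_def by (intro integrable_mult_indicator) auto
    have "((\<lambda>x. poly q x * exp (- x\<^sup>2)) \<longlongrightarrow> 0) at_top"
      using poly_gauss_tendsto_0[of q] at_top_le_at_infinity tendsto_mono by blast
    thus "(((\<lambda>x. poly q x * exp (- x\<^sup>2)) \<circ> real_of_ereal) \<longlongrightarrow> 0) (at_left \<infinity>)"
      by (simp only: ereal_tendsto_simps)
  qed (use assms has_vector_derivative_poly_gauss in \<open>auto intro!: continuous_intros simp: o_def\<close>)
  thus ?thesis by simp
qed

lemma integral_right_part_gauss_deriv:
  "(\<integral>x. right_part a (gauss_deriv q) x \<partial>gauss) = - poly q a * exp (- a\<^sup>2)"
proof -
  have "((\<lambda>x. poly q x * exp (- x\<^sup>2)) \<longlongrightarrow> poly q a * exp (- a\<^sup>2)) (at_right a)"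
    by (intro tendsto_intros)
  hence "(((\<lambda>x. poly q x * exp (- x\<^sup>2)) \<circ> real_of_ereal) \<longlongrightarrow> poly q a * exp (- a\<^sup>2)) (at_right (ereal a))"
    by (simp only: ereal_tendsto_simps)
  hence "(LBINT x=ereal a..\<infinity>. poly (gauss_deriv q) x * exp (- x\<^sup>2)) = - (poly q a * exp (- a\<^sup>2))"
    by (intro LBINT_gauss_deriv) (auto simp: o_def)
  moreover have "(LBINT x=ereal a..\<infinity>. poly (gauss_deriv q) x * exp (- x\<^sup>2)) =
      (\<integral>x. right_part a (gauss_deriv q) x \<partial>gauss)"
    by (simp add: interval_lebesgue_integral_def set_lebesgue_integral_def integral_poly_gauss right_part_def ac_simps)
  ultimately show ?thesis by simp
qed

lemma integral_gauss_deriv: "(\<integral>x. poly (gauss_deriv q) x \<partial>gauss) = 0"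
proof -
  have "((\<lambda>x. poly q x * exp (- x\<^sup>2)) \<longlongrightarrow> 0) at_bot"
    using poly_gauss_tendsto_0[of q] at_bot_le_at_infinity tendsto_mono by blast
  hence "(((\<lambda>x. poly q x * exp (- x\<^sup>2)) \<circ> real_of_ereal) \<longlongrightarrow> 0) (at_right (- \<infinity>))"
    by (simp only: ereal_tendsto_simps)
  hence "(LBINT x=-\<infinity>..\<infinity>. poly (gauss_deriv q) x * exp (- x\<^sup>2)) = - 0"
    by (intro LBINT_gauss_deriv) (auto simp: o_def)
  moreover have "(LBINT x=-\<infinity>..\<infinity>. poly (gauss_deriv q) x * exp (- x\<^sup>2)) =
      (\<integral>x. poly (gauss_deriv q) x \<partial>gauss)"
    by (simp add: interval_lebesgue_integral_def set_lebesgue_integral_def integral_poly_gauss ac_simps)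
  ultimately show ?thesis by simp
qed

text \<open>
  The Hermite differential operator, normalized so that its eigenvalue on \<open>H\<^sub>n\<close> is \<open>n\<close>.
\<close>
definition herm_op :: "real poly \<Rightarrow> real poly" where
  "herm_op p = [:0, 1:] * pderiv p - Polynomial.smult (1/2) (pderiv (pderiv p))"

text \<open>
  Green's formula for the Gaussian weight: the defect of symmetry is a total derivative, so it
  only contributes boundary terms.
\<close>
lemma herm_op_green:
  "herm_op f * g - f * herm_op g = Polynomial.smult (- (1/2)) (gauss_deriv (pderiv f * g - f * pderiv g))"
proof -
  have "poly (herm_op f * g - f * herm_op g) x =
      poly (Polynomial.smult (- (1/2)) (gauss_deriv (pderiv f * g - f * pderiv g))) x" for x
    by (simp add: herm_op_def gauss_deriv_def pderiv_mult pderiv_diff field_simps)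
  thus ?thesis by (simp add: poly_eq_poly_eq_iff[symmetric] fun_eq_iff)
qed

lemma right_part_mult: "right_part a (p * q) x = right_part a p x * poly q x"
  by (simp add: right_part_def)

lemma herm_op_symmetric:
  "(\<integral>x. poly (herm_op f) x * poly g x \<partial>gauss) = (\<integral>x. poly f x * poly (herm_op g) x \<partial>gauss)"
proof -
  have "(\<integral>x. poly (herm_op f * g) x - poly (f * herm_op g) x \<partial>gauss) =
      (\<integral>x. - (1/2) * poly (gauss_deriv (pderiv f * g - f * pderiv g)) x \<partial>gauss)"
    by (simp only: poly_diff[symmetric] herm_op_green poly_smult)
  also have "\<dots> = 0" by (subst integral_mult_right_zero) (simp add: integral_gauss_deriv)
  finally show ?thesis
    by (simp add: gauss.L2_mult_integrable L2_poly)
qed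

text \<open>
  The boundary term at \<open>a\<close> is linear in the pair \<open>f(a)\<close>, \<open>f'(a)\<close>, so a double zero removes it.
\<close>
lemma herm_op_symmetric_right_part:
  assumes "[:-a, 1:]\<^sup>2 dvd f"
  shows "(\<integral>x. right_part a (herm_op f) x * poly g x \<partial>gauss) = (\<integral>x. right_part a f x * poly (herm_op g) x \<partial>gauss)"
proof -
  obtain h where h: "f = [:-a, 1:]\<^sup>2 * h" using assms by blast
  have v: "poly f a = 0" "poly (pderiv f) a = 0"
    by (simp_all add: h power2_eq_square pderiv_mult pderiv_pCons del: mult_pCons_left mult_pCons_right)
  have "(\<integral>x. right_part a (herm_op f * g) x - right_part a (f * herm_op g) x \<partial>gauss) =
      (\<integral>x. - (1/2) * right_part a (gauss_deriv (pderiv f * g - f * pderiv g)) x \<partial>gauss)"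
    (is "?l = ?r")
  proof (rule Bochner_Integration.integral_cong[OF refl])
    fix x
    have "poly (herm_op f * g - f * herm_op g) x = - (1/2) * poly (gauss_deriv (pderiv f * g - f * pderiv g)) x"
      by (simp only: herm_op_green poly_smult)
    thus "right_part a (herm_op f * g) x - right_part a (f * herm_op g) x =
        - (1/2) * right_part a (gauss_deriv (pderiv f * g - f * pderiv g)) x"
      by (auto simp: right_part_def indicator_def)
  qed
  also have "?r = 0" by (subst integral_mult_right_zero) (simp add: integral_right_part_gauss_deriv v)
  finally show ?thesis
    by (simp add: right_part_mult gauss.L2_mult_integrable L2_right_part L2_poly)
qed

fun hermite_poly :: "nat \<Rightarrow> real poly" where
  "hermite_poly 0 = 1"
| "hermite_poly (Suc n) = [:0, 2:] * hermite_poly n - pderiv (hermite_poly n)"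

lemma funpow_deriv_gauss:
  "(deriv ^^ n) (\<lambda>t. exp (- t\<^sup>2)) = (\<lambda>x. (-1) ^ n * poly (hermite_poly n) x * exp (- x\<^sup>2))"
proof (induction n)
  case 0
  show ?case by simp
next
  case (Suc n)
  show ?case
  proof
    fix x :: real
    have "((\<lambda>x. (-1) ^ n * poly (hermite_poly n) x * exp (- x\<^sup>2)) has_real_derivative
        (-1) ^ Suc n * poly (hermite_poly (Suc n)) x * exp (- x\<^sup>2)) (at x)"
      by (auto intro!: derivative_eq_intros simp: algebra_simps power2_eq_square)
    thus "(deriv ^^ Suc n) (\<lambda>t. exp (- t\<^sup>2)) x = (-1) ^ Suc n * poly (hermite_poly (Suc n)) x * exp (- x\<^sup>2)"
      using Suc.IH by (simp only: funpow.simps o_apply DERIV_imp_deriv)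
  qed
qed

lemma hermite_eq_poly: "hermite n = poly (hermite_poly n)"
proof
  fix x
  have "hermite n x = ((-1) ^ n * (-1) ^ n) * poly (hermite_poly n) x * (exp (x\<^sup>2) * exp (- x\<^sup>2))"
    unfolding hermite_def funpow_deriv_gauss by (simp only: ac_simps)
  thus "hermite n x = poly (hermite_poly n) x"
    by (simp add: power_mult_distrib[symmetric] exp_add[symmetric])
qed

lemma degree_hermite_poly: "Polynomial.degree (hermite_poly n) = n"
  and coeff_hermite_poly: "Polynomial.coeff (hermite_poly n) n = 2 ^ n"
proof (induction n)
  case (Suc n)
  have nz: "hermite_poly n \<noteq> 0" using Suc(2) by auto
  have d: "Polynomial.degree ([:0, 2:] * hermite_poly n) = Suc n"
    using nz Suc(1) by (simp add: degree_mult_eq del: mult_pCons_left)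
  have lt: "Polynomial.degree (pderiv (hermite_poly n)) < Suc n"
    using Suc(1) by (simp add: degree_pderiv)
  case 2
  show c: ?case
    using Suc(2) lt by (simp add: coeff_eq_0)
  case 1
  have "Polynomial.degree (hermite_poly (Suc n)) \<le> Suc n"
    unfolding hermite_poly.simps using lt d by (intro degree_diff_le) auto
  moreover have "Polynomial.degree (hermite_poly (Suc n)) \<ge> Suc n"
    by (rule le_degree) (simp only: c, simp)
  ultimately show ?case by (rule antisym)
qed simp_all

lemma pderiv_hermite_poly:
  "pderiv (hermite_poly (Suc n)) = Polynomial.smult (2 * of_nat (Suc n)) (hermite_poly n)"
proof (induction n)
  case (Suc n)
  have "pderiv (hermite_poly (Suc (Suc n))) =
      Polynomial.smult 2 (hermite_poly (Suc n)) + [:0, 2:] * pderiv (hermite_poly (Suc n))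
        - pderiv (pderiv (hermite_poly (Suc n)))"
    unfolding hermite_poly.simps(2)[of "Suc n"]
    by (simp add: pderiv_diff pderiv_mult pderiv_pCons pderiv_smult del: hermite_poly.simps)
  also have "\<dots> = Polynomial.smult 2 (hermite_poly (Suc n)) +
      Polynomial.smult (2 * of_nat (Suc n)) ([:0, 2:] * hermite_poly n - pderiv (hermite_poly n))"
    unfolding Suc.IH pderiv_smult smult_diff_right mult_smult_right by simp
  also have "\<dots> = Polynomial.smult (2 * of_nat (Suc (Suc n))) (hermite_poly (Suc n))"
    unfolding hermite_poly.simps(2)[of n, symmetric] smult_add_left[symmetric] by simp
  finally show ?case .
qed (simp add: pderiv_pCons)

lemma herm_op_hermite_poly: "herm_op (hermite_poly n) = Polynomial.smult (of_nat n) (hermite_poly n)"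
proof (cases n)
  case 0
  thus ?thesis by (simp add: herm_op_def)
next
  case (Suc m)
  have "herm_op (hermite_poly (Suc m)) =
      Polynomial.smult (of_nat (Suc m)) ([:0, 2:] * hermite_poly m - pderiv (hermite_poly m))"
    unfolding herm_op_def pderiv_hermite_poly pderiv_smult
    by (simp add: smult_diff_right mult.commute del: of_nat_Suc)
  thus ?thesis unfolding Suc hermite_poly.simps(2)[of m, symmetric] .
qed

lemma hermite_poly_expansion:
  assumes "Polynomial.degree p \<le> N"
  shows "\<exists>c. p = (\<Sum>n\<le>N. Polynomial.smult (c n) (hermite_poly n))"
  using assms
proof (induction N arbitrary: p)
  case 0
  then obtain a where "p = [:a:]" by (metis degree_eq_zeroE le_zero_eq)
  thus ?case by (intro exI[of _ "\<lambda>_. a"]) simp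
next
  case (Suc N)
  define b where "b = Polynomial.coeff p (Suc N) / 2 ^ Suc N"
  define q where "q = p - Polynomial.smult b (hermite_poly (Suc N))"
  have "Polynomial.degree q \<le> N"
  proof (rule degree_le, intro allI impI)
    fix i assume i: "N < i"
    show "Polynomial.coeff q i = 0"
    proof (cases "i = Suc N")
      case True
      thus ?thesis using coeff_hermite_poly[of "Suc N"]
        by (simp add: q_def b_def del: hermite_poly.simps power_Suc)
    next
      case False
      hence "Suc N < i" using i by simp
      thus ?thesis using Suc.prems degree_hermite_poly[of "Suc N"]
        by (simp add: q_def coeff_eq_0 del: hermite_poly.simps)
    qed
  qed
  from Suc.IH[OF this] obtain c where c: "q = (\<Sum>n\<le>N. Polynomial.smult (c n) (hermite_poly n))" by blast
  have "p = q + Polynomial.smult b (hermite_poly (Suc N))" by (simp add: q_def)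
  also have "\<dots> = (\<Sum>n\<le>Suc N. Polynomial.smult ((c(Suc N := b)) n) (hermite_poly n))"
  proof -
    have "(\<Sum>n\<le>N. Polynomial.smult ((c(Suc N := b)) n) (hermite_poly n)) = q"
      unfolding c by (intro sum.cong) auto
    thus ?thesis by (simp del: hermite_poly.simps)
  qed
  finally show ?case by blast
qed

section \<open>Hermite expansions\<close>

lemma AE_gauss_iff: "(AE x in gauss. P x) \<longleftrightarrow> (AE x in lborel. P x)"
  unfolding poly_gauss_def by (subst AE_density) auto

lemma poly_eq_0_of_AE:
  fixes q :: "real poly"
  assumes "a < b" and ae: "AE x in lborel. a < x \<longrightarrow> x < b \<longrightarrow> poly q x = 0"
  shows "q = 0"
proof (rule ccontr)
  assume "q \<noteq> 0"
  hence "finite {x. poly q x = 0}" by (rule poly_roots_finite)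
  hence "AE x in lborel. x \<notin> {x. poly q x = 0}"
    by (intro AE_not_in finite_imp_null_set_lborel)
  with ae have "AE x in lborel. x \<notin> {a<..<b}"
    by eventually_elim auto
  hence "emeasure lborel {a<..<b} = 0"
    by (subst (asm) AE_iff_measurable[OF _ refl]) (auto simp: greaterThanLessThan_def greaterThan_def lessThan_def Collect_conj_eq)
  thus False using \<open>a < b\<close> by simp
qed

definition gnorm :: "nat \<Rightarrow> real" where
  "gnorm n = (\<integral>x. (poly (hermite_poly n) x)\<^sup>2 \<partial>gauss)"

text \<open>
  These Fourier coefficients are not normalized; \<open>gnorm\<close> is the squared norm of the \<open>n\<close>-th Hermite
  polynomial.
\<close>
definition hcoeff :: "(real \<Rightarrow> real) \<Rightarrow> nat \<Rightarrow> real" where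
  "hcoeff u n = (\<integral>x. u x * poly (hermite_poly n) x \<partial>gauss)"

lemma gnorm_pos: "gnorm n > 0"
proof -
  have "gnorm n \<noteq> 0"
  proof
    assume "gnorm n = 0"
    hence "AE x in gauss. (poly (hermite_poly n) x)\<^sup>2 = 0"
      using L2_poly[of "hermite_poly n"] unfolding gnorm_def L2_def
      by (subst (asm) integral_nonneg_eq_0_iff_AE) auto
    hence "AE x in lborel. 0 < x \<longrightarrow> x < 1 \<longrightarrow> poly (hermite_poly n) x = 0"
      unfolding AE_gauss_iff by eventually_elim simp
    hence "hermite_poly n = 0" by (intro poly_eq_0_of_AE[of 0 1]) auto
    thus False using coeff_hermite_poly[of n] by simp
  qed
  moreover have "gnorm n \<ge> 0" unfolding gnorm_def by (intro integral_nonneg_AE) auto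
  ultimately show ?thesis by simp
qed

lemma hcoeff_sum_poly:
  "(\<integral>x. u x * poly (\<Sum>i\<in>I. Polynomial.smult (c i) (hermite_poly (k i))) x \<partial>gauss) =
    (\<Sum>i\<in>I. c i * hcoeff u (k i))" if "L2 gauss u"
proof -
  have "(\<integral>x. u x * poly (\<Sum>i\<in>I. Polynomial.smult (c i) (hermite_poly (k i))) x \<partial>gauss) =
     (\<integral>x. (\<Sum>i\<in>I. c i * (u x * poly (hermite_poly (k i)) x)) \<partial>gauss)"
    by (intro Bochner_Integration.integral_cong refl) (simp add: poly_sum sum_distrib_left mult.left_commute)
  also have "\<dots> = (\<Sum>i\<in>I. c i * hcoeff u (k i))"
    unfolding hcoeff_def
    by (subst Bochner_Integration.integral_sum) (auto intro!: gauss.L2_mult_integrable L2_poly that)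
  finally show ?thesis .
qed

text \<open>
  Eigenvectors of the symmetric operator \<open>herm_op\<close> for different eigenvalues.
\<close>
lemma hermite_poly_orthogonal:
  "hcoeff (poly (hermite_poly m)) n = (if m = n then gnorm n else 0)"
proof (cases "m = n")
  case True
  thus ?thesis by (simp add: hcoeff_def gnorm_def power2_eq_square)
next
  case False
  have "of_nat m * hcoeff (poly (hermite_poly m)) n = of_nat n * hcoeff (poly (hermite_poly m)) n"
    using herm_op_symmetric[of "hermite_poly m" "hermite_poly n"]
    by (simp add: herm_op_hermite_poly hcoeff_def mult.assoc mult.left_commute)
  thus ?thesis using False by simp
qed

lemma hcoeff_sum:
  "hcoeff (poly (\<Sum>i\<in>I. Polynomial.smult (c i) (hermite_poly (k i)))) n =
    (\<Sum>i\<in>I. if k i = n then c i * gnorm n else 0)"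
proof -
  have "hcoeff (poly (\<Sum>i\<in>I. Polynomial.smult (c i) (hermite_poly (k i)))) n =
    (\<integral>x. poly (hermite_poly n) x * poly (\<Sum>i\<in>I. Polynomial.smult (c i) (hermite_poly (k i))) x \<partial>gauss)"
    unfolding hcoeff_def by (simp add: mult.commute)
  also have "\<dots> = (\<Sum>i\<in>I. c i * hcoeff (poly (hermite_poly n)) (k i))"
    by (rule hcoeff_sum_poly[OF L2_poly])
  finally show ?thesis by (simp add: hermite_poly_orthogonal if_distrib eq_commute cong: if_cong)
qed

lemma hcoeff_diff:
  "L2 gauss u \<Longrightarrow> L2 gauss v \<Longrightarrow> hcoeff (\<lambda>x. u x - v x) n = hcoeff u n - hcoeff v n"
  unfolding hcoeff_def left_diff_distrib
  by (intro Bochner_Integration.integral_diff gauss.L2_mult_integrable L2_poly)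

lemma integral_mult_poly_eq_0:
  assumes "L2 gauss u" "\<And>n. n \<le> N \<Longrightarrow> hcoeff u n = 0" "Polynomial.degree p \<le> N"
  shows "(\<integral>x. u x * poly p x \<partial>gauss) = 0"
proof -
  obtain c where c: "p = (\<Sum>n\<le>N. Polynomial.smult (c n) (hermite_poly n))"
    using hermite_poly_expansion[OF assms(3)] by blast
  show ?thesis unfolding c by (subst hcoeff_sum_poly) (use assms in auto)
qed

lemma integral_sq_diff_poly:
  assumes u: "L2 gauss u" "\<And>n. n \<le> N \<Longrightarrow> hcoeff u n = 0" "Polynomial.degree p \<le> N"
  shows "(\<integral>x. (u x)\<^sup>2 \<partial>gauss) \<le> (\<integral>x. (u x - poly p x)\<^sup>2 \<partial>gauss)"
proof -
  have i: "integrable gauss (\<lambda>x. (u x)\<^sup>2)" "integrable gauss (\<lambda>x. (poly p x)\<^sup>2)"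
    "integrable gauss (\<lambda>x. u x * poly p x)"
    using u(1) L2_poly[of p] gauss.L2_mult_integrable[OF u(1) L2_poly] by (auto simp: L2_def)
  have "(\<integral>x. (u x - poly p x)\<^sup>2 \<partial>gauss) =
      (\<integral>x. (u x)\<^sup>2 + (poly p x)\<^sup>2 - 2 * (u x * poly p x) \<partial>gauss)"
    by (simp add: power2_diff mult.assoc)
  also have "\<dots> = (\<integral>x. (u x)\<^sup>2 \<partial>gauss) + (\<integral>x. (poly p x)\<^sup>2 \<partial>gauss)"
    using i integral_mult_poly_eq_0[OF u] by simp
  finally show ?thesis by (simp add: integral_nonneg_AE)
qed

lemma L2_poly_close:
  assumes "L2 gauss u" "e > 0"
  shows "\<exists>p. (\<integral>x. (u x - poly p x)\<^sup>2 \<partial>gauss) < e"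
proof -
  have "gauss.poly_approx u" using assms(1) by (intro gauss.poly_approx_L2) (auto simp: L2_def)
  thus ?thesis using assms(2) unfolding gauss.poly_approx_def by blast
qed

text \<open>
  A function orthogonal to all polynomials has distance at least its own norm from each of them,
  whereas polynomials come arbitrarily close.
\<close>
lemma AE_eq_0_if_hcoeff_0:
  assumes u: "L2 gauss u" and 0: "\<And>n. hcoeff u n = 0"
  shows "AE x in lborel. u x = 0"
proof -
  have "(\<integral>x. (u x)\<^sup>2 \<partial>gauss) \<le> 0"
  proof (rule field_le_epsilon)
    fix e :: real assume "e > 0"
    then obtain p where "(\<integral>x. (u x - poly p x)\<^sup>2 \<partial>gauss) < e" using L2_poly_close[OF u] by blast
    with integral_sq_diff_poly[OF u 0 order_refl, of p]
    show "(\<integral>x. (u x)\<^sup>2 \<partial>gauss) \<le> 0 + e" by simp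
  qed
  hence "(\<integral>x. (u x)\<^sup>2 \<partial>gauss) = 0" by (simp add: integral_nonneg_AE antisym)
  hence "AE x in gauss. (u x)\<^sup>2 = 0"
    using u unfolding L2_def by (subst (asm) integral_nonneg_eq_0_iff_AE) auto
  thus ?thesis by (simp add: AE_gauss_iff)
qed

text \<open>
  This is the part of Parseval's formula
  \<open>\<langle>u, v\<rangle> = \<Sum>\<^sub>n \<langle>u, H\<^sub>n\<rangle> \<langle>v, H\<^sub>n\<rangle> / \<parallel>H\<^sub>n\<parallel>\<^sup>2\<close> that survives for nonnegative terms: if the sum is zero, so
  is each term. The partial sums equal \<open>\<langle>r, v\<rangle>\<close> for the orthogonal projection \<open>r\<close> of \<open>u\<close> to polynomials
  of bounded degree, and \<open>\<langle>u - r, v\<rangle>\<close> becomes small with \<open>u - r\<close>.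
\<close>
lemma hcoeff_prod_0:
  assumes u: "L2 gauss u" and v: "L2 gauss v" and uv: "(\<integral>x. u x * v x \<partial>gauss) = 0"
    and nn: "\<And>n. hcoeff u n * hcoeff v n \<ge> 0"
  shows "hcoeff u m * hcoeff v m = 0"
proof (rule ccontr)
  assume "hcoeff u m * hcoeff v m \<noteq> 0"
  define d where "d = hcoeff u m * hcoeff v m / gnorm m"
  have d: "d > 0" using nn[of m] \<open>hcoeff u m * hcoeff v m \<noteq> 0\<close> gnorm_pos[of m]
    unfolding d_def by (intro divide_pos_pos) linarith+
  define V where "V = (\<integral>x. (v x)\<^sup>2 \<partial>gauss)"
  have V: "V \<ge> 0" unfolding V_def by (intro integral_nonneg_AE) auto
  \<comment> \<open>The weight in \<open>2 |w v| \<le> K w\<^sup>2 + v\<^sup>2 / K\<close>: large enough that the second term integrates to less than \<open>d\<close>.\<close>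
  define K where "K = (V + 1) / d"
  have K: "K > 0" using V d by (simp add: K_def)
  obtain p where p: "(\<integral>x. (u x - poly p x)\<^sup>2 \<partial>gauss) < d / K"
    using L2_poly_close[OF u, of "d / K"] d K by auto
  define N where "N = max m (Polynomial.degree p)"
  define r where "r = (\<Sum>n\<le>N. Polynomial.smult (hcoeff u n / gnorm n) (hermite_poly n))"
  define w where "w = (\<lambda>x. u x - poly r x)"
  have w: "L2 gauss w" unfolding w_def by (intro gauss.L2_diff u L2_poly)
  have "hcoeff w n = 0" if "n \<le> N" for n
    using that gnorm_pos[of n] unfolding w_def r_def
    by (simp add: hcoeff_diff[OF u L2_poly] hcoeff_sum)
  moreover have "Polynomial.degree (p - r) \<le> N"
  proof (rule degree_diff_le)
    show "Polynomial.degree r \<le> N" unfolding r_def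
      by (intro degree_sum_le) (auto intro: order.trans[OF degree_smult_le] simp: degree_hermite_poly)
  qed (simp add: N_def)
  ultimately have "(\<integral>x. (w x)\<^sup>2 \<partial>gauss) \<le> (\<integral>x. (w x - poly (p - r) x)\<^sup>2 \<partial>gauss)"
    by (intro integral_sq_diff_poly w)
  also have "\<dots> = (\<integral>x. (u x - poly p x)\<^sup>2 \<partial>gauss)" by (simp add: w_def)
  finally have W: "(\<integral>x. (w x)\<^sup>2 \<partial>gauss) < d / K" using p by simp
  have "d \<le> (\<Sum>n\<le>N. hcoeff u n * hcoeff v n / gnorm n)"
    unfolding d_def using nn gnorm_pos
    by (intro member_le_sum[of m "{..N}" "\<lambda>n. hcoeff u n * hcoeff v n / gnorm n"])
      (auto simp: N_def intro!: divide_nonneg_pos)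
  also have "\<dots> = (\<integral>x. v x * poly r x \<partial>gauss)"
    unfolding r_def by (subst hcoeff_sum_poly[OF v]) (simp add: algebra_simps)
  also have "\<dots> = (\<integral>x. u x * v x - w x * v x \<partial>gauss)" by (simp add: w_def algebra_simps)
  also have "\<dots> = (\<integral>x. - (w x * v x) \<partial>gauss)"
    using gauss.L2_mult_integrable[OF u v] gauss.L2_mult_integrable[OF w v] uv by simp
  also have "\<dots> \<le> (\<integral>x. (K * (w x)\<^sup>2 + (1 / K) * (v x)\<^sup>2) / 2 \<partial>gauss)"
  proof (rule integral_mono)
    show "integrable gauss (\<lambda>x. - (w x * v x))" using gauss.L2_mult_integrable[OF w v] by simp
    show "integrable gauss (\<lambda>x. (K * (w x)\<^sup>2 + (1 / K) * (v x)\<^sup>2) / 2)"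
      using w v by (auto simp: L2_def)
    fix x
    have "0 \<le> (K * w x + v x)\<^sup>2 / K" using K by simp
    also have "\<dots> = K * (w x)\<^sup>2 + (1 / K) * (v x)\<^sup>2 + 2 * (w x * v x)"
      using K by (simp add: power2_eq_square field_simps)
    finally show "- (w x * v x) \<le> (K * (w x)\<^sup>2 + (1 / K) * (v x)\<^sup>2) / 2" by simp
  qed
  also have "\<dots> = (K * (\<integral>x. (w x)\<^sup>2 \<partial>gauss) + (1 / K) * V) / 2"
    using w v by (simp add: L2_def V_def)
  also have "\<dots> < (d + d) / 2"
  proof -
    have "K * (\<integral>x. (w x)\<^sup>2 \<partial>gauss) < d" using W K by (simp add: field_simps)
    moreover have "(1 / K) * V \<le> d" using d V by (simp add: K_def field_simps)
    ultimately show ?thesis by simp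
  qed
  finally show False by simp
qed

section \<open>High-order zeros of combinations of Hermite polynomials\<close>

text \<open>
  The operator \<open>\<Prod>(A - a)\<close> for \<open>A = herm_op\<close>. The factors commute, but keeping them in the order
  of a list avoids having to show it: taking adjoints then reverses the list.
\<close>
definition shift_op :: "real list \<Rightarrow> real poly \<Rightarrow> real poly" where
  "shift_op as = fold (\<lambda>a p. herm_op p - Polynomial.smult a p) as"

lemma herm_op_add: "herm_op (p + q) = herm_op p + herm_op q"
  by (simp add: herm_op_def pderiv_add smult_add_right algebra_simps)

lemma herm_op_smult: "herm_op (Polynomial.smult c p) = Polynomial.smult c (herm_op p)"
  by (simp add: herm_op_def pderiv_smult smult_diff_right mult_smult_right mult.commute)

lemma shift_op_Nil [simp]: "shift_op [] p = p"
  and shift_op_Cons: "shift_op (a # as) p = shift_op as (herm_op p - Polynomial.smult a p)"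
  and shift_op_snoc: "shift_op (as @ [a]) p = herm_op (shift_op as p) - Polynomial.smult a (shift_op as p)"
  by (simp_all add: shift_op_def)

lemma shift_op_add: "shift_op as (p + q) = shift_op as p + shift_op as q"
  by (induction as rule: rev_induct) (simp_all add: shift_op_snoc herm_op_add smult_add_right)

lemma shift_op_smult: "shift_op as (Polynomial.smult c p) = Polynomial.smult c (shift_op as p)"
  by (induction as rule: rev_induct)
    (simp_all add: shift_op_snoc herm_op_smult smult_diff_right mult.commute)

lemma shift_op_sum: "shift_op as (\<Sum>i\<in>I. f i) = (\<Sum>i\<in>I. shift_op as (f i))"
proof (induction I rule: infinite_finite_induct)
  case empty
  show ?case using shift_op_smult[of as 0 0] by simp
next
  case (infinite I)
  thus ?case using shift_op_smult[of as 0 0] by simp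
qed (simp_all add: shift_op_add)

lemma shift_op_hermite_poly:
  "shift_op as (hermite_poly n) = Polynomial.smult (\<Prod>a\<leftarrow>as. of_nat n - a) (hermite_poly n)"
  by (induction as rule: rev_induct)
    (simp_all add: shift_op_snoc herm_op_smult herm_op_hermite_poly smult_diff_left[symmetric] algebra_simps)

lemma power_dvd_pderiv: "[:-a, 1:] ^ Suc n dvd p \<Longrightarrow> [:-a, 1:] ^ n dvd pderiv p" for p :: "real poly"
proof -
  assume "[:-a, 1:] ^ Suc n dvd p"
  then obtain q where "p = [:-a, 1:] ^ Suc n * q" by blast
  thus ?thesis
    using lemma_order_pderiv1[of a n q]
    by (simp del: of_nat_Suc mult_pCons_left) (metis dvd_add dvd_mult dvd_mult2 dvd_smult dvd_triv_left dvd_triv_right)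
qed

text \<open>
  A second-order operator lowers the order of a zero by at most two.
\<close>
lemma power_dvd_herm_op:
  assumes "[:-a, 1:] ^ (n + 2) dvd p"
  shows "[:-a, 1:] ^ n dvd herm_op p - Polynomial.smult c p"
proof -
  have "[:-a, 1:] ^ Suc n dvd pderiv p" "[:-a, 1:] ^ n dvd pderiv (pderiv p)"
    using assms by (auto intro!: power_dvd_pderiv simp del: power_Suc)
  moreover have "[:-a, 1:] ^ n dvd p" "[:-a, 1:] ^ n dvd pderiv p"
    by (rule power_le_dvd[OF assms], simp) (rule power_le_dvd[OF calculation(1)], simp)
  ultimately show ?thesis unfolding herm_op_def
    by (intro dvd_diff dvd_smult dvd_mult)
qed

text \<open>
  Each of the factors moved to the other side needs a double zero at \<open>x0\<close> and lowers the order of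
  the zero by two, so a zero of order twice the number of factors is enough to move all of them.
\<close>
lemma shift_op_symmetric_right_part:
  assumes "[:-x0, 1:] ^ (2 * length as) dvd f"
  shows "(\<integral>x. right_part x0 (shift_op as f) x * poly g x \<partial>gauss) =
    (\<integral>x. right_part x0 f x * poly (shift_op (rev as) g) x \<partial>gauss)"
  using assms
proof (induction as arbitrary: f)
  case Nil
  show ?case by simp
next
  case (Cons a as)
  let ?g = "shift_op (rev as) g"
  have d: "[:-x0, 1:] ^ (2 * length as) dvd herm_op f - Polynomial.smult a f"
    using Cons.prems by (intro power_dvd_herm_op) simp
  have d2: "[:-x0, 1:]\<^sup>2 dvd f" by (rule power_le_dvd[OF Cons.prems]) simp
  have cs: "right_part x0 (herm_op f - Polynomial.smult a f) x = right_part x0 (herm_op f) x - a * right_part x0 f x" for x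
    by (simp add: right_part_def algebra_simps)
  have i: "integrable gauss (\<lambda>x. right_part x0 h x * poly k x)" for h k
    by (intro gauss.L2_mult_integrable L2_right_part L2_poly)
  have "(\<integral>x. right_part x0 (shift_op (a # as) f) x * poly g x \<partial>gauss) =
      (\<integral>x. right_part x0 (herm_op f - Polynomial.smult a f) x * poly ?g x \<partial>gauss)"
    unfolding shift_op_Cons by (rule Cons.IH[OF d])
  also have "\<dots> = (\<integral>x. right_part x0 (herm_op f) x * poly ?g x - a * (right_part x0 f x * poly ?g x) \<partial>gauss)"
    by (simp add: cs algebra_simps)
  also have "\<dots> = (\<integral>x. right_part x0 (herm_op f) x * poly ?g x \<partial>gauss) - a * (\<integral>x. right_part x0 f x * poly ?g x \<partial>gauss)"
    using i by simp
  also have "\<dots> = (\<integral>x. right_part x0 f x * poly (herm_op ?g) x \<partial>gauss) - a * (\<integral>x. right_part x0 f x * poly ?g x \<partial>gauss)"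
    by (simp add: herm_op_symmetric_right_part[OF d2])
  also have "\<dots> = (\<integral>x. right_part x0 f x * poly (herm_op ?g) x - a * (right_part x0 f x * poly ?g x) \<partial>gauss)"
    using i by simp
  also have "\<dots> = (\<integral>x. right_part x0 f x * poly (shift_op (rev (a # as)) g) x \<partial>gauss)"
    by (simp add: shift_op_snoc algebra_simps)
  finally show ?case .
qed

text \<open>
  The heart of the Krein--Adler theorem, by the quadratic form argument described at the
  beginning. The order \<open>2 m\<close> of the zero, with \<open>m\<close> pairs, suffices although \<open>R(A) S(A)\<close> has order
  \<open>4 m\<close>, because only \<open>R(A)\<close> or only \<open>S(A)\<close> has to act on the truncated function.
\<close>
theorem hermite_span_no_high_order_zero:
  fixes as :: "nat list" and v :: "nat \<Rightarrow> real"
  assumes dvd: "[:-x0, 1:] ^ (2 * length as) dvd (\<Sum>k\<in>K. Polynomial.smult (v k) (hermite_poly k))"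
    and K: "K = set as \<union> Suc ` set as" and "k \<in> K"
  shows "v k = 0"
proof -
  define f where "f = (\<Sum>k\<in>K. Polynomial.smult (v k) (hermite_poly k))"
  have finK: "finite K" by (simp add: K)
  \<comment> \<open>The roots of \<open>R\<close> and of \<open>S\<close>.\<close>
  define r s where "r = map real as" and "s = map (real \<circ> Suc) as"
  define R S where "R = (\<lambda>n::nat. \<Prod>a\<leftarrow>r. real n - a)" and "S = (\<lambda>n::nat. \<Prod>a\<leftarrow>s. real n - a)"
  define c where "c = hcoeff (right_part x0 f)"
  have RS: "R n * S n \<ge> 0" and RS0: "R n * S n = 0 \<longleftrightarrow> n \<in> K" for n
  proof -
    have *: "(real n - real a) * (real n - real (Suc a)) \<ge> 0" for a
      by (cases "n \<le> a") (auto intro: mult_nonpos_nonpos)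
    have "(\<Prod>a\<leftarrow>bs. real n - real a) * (\<Prod>a\<leftarrow>bs. real n - real (Suc a)) =
        (\<Prod>a\<leftarrow>bs. (real n - real a) * (real n - real (Suc a)))" for bs
      by (induction bs) (simp_all add: ac_simps)
    hence eq: "R n * S n = (\<Prod>a\<leftarrow>as. (real n - real a) * (real n - real (Suc a)))"
      by (simp add: R_def S_def r_def s_def o_def)
    show "R n * S n \<ge> 0" unfolding eq using * by (induction as) (auto simp del: of_nat_Suc)
    show "R n * S n = 0 \<longleftrightarrow> n \<in> K"
      unfolding eq K prod_list_zero_iff by (auto simp: image_iff simp del: of_nat_Suc)
  qed
  have prod_rev: "(\<Prod>a\<leftarrow>rev bs. real n - a) = (\<Prod>a\<leftarrow>bs. real n - a)" for bs n
    by (induction bs) (simp_all add: ac_simps)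
  have coef: "hcoeff (right_part x0 (shift_op bs f)) n = (\<Prod>a\<leftarrow>bs. real n - a) * c n"
    if "length bs = length as" for bs n
  proof -
    have "hcoeff (right_part x0 (shift_op bs f)) n =
        (\<integral>x. right_part x0 f x * poly (shift_op (rev bs) (hermite_poly n)) x \<partial>gauss)"
      unfolding hcoeff_def using dvd that by (intro shift_op_symmetric_right_part) (simp add: f_def)
    also have "\<dots> = (\<integral>x. (\<Prod>a\<leftarrow>bs. real n - a) * (right_part x0 f x * poly (hermite_poly n) x) \<partial>gauss)"
      unfolding shift_op_hermite_poly prod_rev poly_smult by (simp only: mult.left_commute)
    also have "\<dots> = (\<Prod>a\<leftarrow>bs. real n - a) * c n"
      unfolding c_def hcoeff_def by (rule integral_mult_right_zero)
    finally show ?thesis .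
  qed
  have cu: "hcoeff (right_part x0 (shift_op r f)) n = R n * c n"
    and cv: "hcoeff (right_part x0 (shift_op s f)) n = S n * c n" for n
    using coef[of r n] coef[of s n] by (auto simp: r_def s_def R_def S_def)
  \<comment> \<open>Move \<open>R(A)\<close> across; \<open>R(A) S(A)\<close> annihilates \<open>f\<close>.\<close>
  have "(\<integral>x. right_part x0 (shift_op r f) x * right_part x0 (shift_op s f) x \<partial>gauss) =
      (\<integral>x. right_part x0 (shift_op r f) x * poly (shift_op s f) x \<partial>gauss)"
    by (intro Bochner_Integration.integral_cong) (auto simp: right_part_def indicator_def)
  also have "\<dots> = (\<integral>x. right_part x0 f x * poly (shift_op (rev r) (shift_op s f)) x \<partial>gauss)"
    using dvd by (intro shift_op_symmetric_right_part) (simp add: f_def r_def)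
  also have "shift_op (rev r) (shift_op s f) = (\<Sum>k\<in>K. Polynomial.smult (v k * (R k * S k)) (hermite_poly k))"
    unfolding f_def shift_op_sum shift_op_smult shift_op_hermite_poly prod_rev R_def S_def
    by (simp add: ac_simps)
  also have "\<dots> = 0" using RS0 by (intro sum.neutral) auto
  finally have 0: "(\<integral>x. right_part x0 (shift_op r f) x * right_part x0 (shift_op s f) x \<partial>gauss) = 0" by simp
  have c0: "c n = 0" if "n \<notin> K" for n
  proof -
    have "hcoeff (right_part x0 (shift_op r f)) n * hcoeff (right_part x0 (shift_op s f)) n = 0"
    proof (rule hcoeff_prod_0[OF L2_right_part L2_right_part 0])
      fix n
      have "0 \<le> (R n * S n) * (c n)\<^sup>2" using RS by simp
      thus "0 \<le> hcoeff (right_part x0 (shift_op r f)) n * hcoeff (right_part x0 (shift_op s f)) n"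
        unfolding cu cv by (simp add: power2_eq_square ac_simps)
    qed
    hence "(R n * S n) * (c n * c n) = 0" unfolding cu cv by (simp only: ac_simps)
    thus ?thesis using RS0[of n] that by simp
  qed
  \<comment> \<open>The Hermite expansion of the truncated \<open>f\<close>, which is a finite sum.\<close>
  define q where "q = (\<Sum>k\<in>K. Polynomial.smult (c k / gnorm k) (hermite_poly k))"
  have "AE x in lborel. right_part x0 f x - poly q x = 0"
  proof (rule AE_eq_0_if_hcoeff_0)
    show "L2 gauss (\<lambda>x. right_part x0 f x - poly q x)" by (intro gauss.L2_diff L2_right_part L2_poly)
    fix n
    have "hcoeff (poly q) n = c n"
      unfolding q_def hcoeff_sum using finK c0 gnorm_pos[of n] by (cases "n \<in> K") auto
    thus "hcoeff (\<lambda>x. right_part x0 f x - poly q x) n = 0"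
      by (simp add: hcoeff_diff[OF L2_right_part L2_poly] c_def)
  qed
  hence ae: "AE x in lborel. right_part x0 f x = poly q x" by simp
  have "AE x in lborel. x0 - 1 < x \<longrightarrow> x < x0 \<longrightarrow> poly q x = 0"
    using ae by eventually_elim (auto simp: right_part_def)
  hence "q = 0" by (intro poly_eq_0_of_AE[of "x0 - 1" x0]) auto
  have "AE x in lborel. x0 < x \<longrightarrow> x < x0 + 1 \<longrightarrow> poly f x = 0"
    using ae by eventually_elim (auto simp: right_part_def \<open>q = 0\<close>)
  hence "f = 0" by (intro poly_eq_0_of_AE[of x0 "x0 + 1"]) auto
  have "v k * gnorm k = hcoeff (poly f) k"
    unfolding f_def hcoeff_sum using finK \<open>k \<in> K\<close> by simp
  also have "\<dots> = 0" by (simp add: \<open>f = 0\<close> hcoeff_def)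
  finally show ?thesis using gnorm_pos[of k] by simp
qed

section \<open>Wronskians of polynomials\<close>

definition wr_mat :: "real poly list \<Rightarrow> real poly mat" where
  "wr_mat ps = Matrix.mat (length ps) (length ps) (\<lambda>(i, j). (pderiv ^^ i) (ps ! j))"

definition wr_poly :: "real poly list \<Rightarrow> real poly" where
  "wr_poly ps = Determinant.det (wr_mat ps)"

lemma wr_mat_carrier [simp]: "wr_mat ps \<in> carrier_mat (length ps) (length ps)"
  by (simp add: wr_mat_def)

lemma funpow_deriv_poly: "(deriv ^^ i) (poly p) = poly ((pderiv ^^ i) p)" for p :: "real poly"
proof (induction i)
  case (Suc i)
  have "deriv (poly q) = poly (pderiv q)" for q :: "real poly"
    by (rule ext) (rule DERIV_imp_deriv[OF poly_DERIV])
  thus ?case using Suc.IH by simp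
qed simp

lemma poly_wr_poly:
  "poly (wr_poly ps) x =
    Determinant.det (Matrix.mat (length ps) (length ps) (\<lambda>(i, j). poly ((pderiv ^^ i) (ps ! j)) x))"
proof -
  interpret comm_ring_hom "\<lambda>p :: real poly. poly p x" by unfold_locales auto
  have "map_mat (\<lambda>p. poly p x) (wr_mat ps) =
      Matrix.mat (length ps) (length ps) (\<lambda>(i, j). poly ((pderiv ^^ i) (ps ! j)) x)"
    by (rule eq_matI) (auto simp: wr_mat_def)
  thus ?thesis using hom_det[of "wr_mat ps"] by (simp add: wr_poly_def)
qed

lemma wronskian_eq_poly: "wronskian (map poly ps) = poly (wr_poly ps)"
proof
  fix x
  have "Matrix.mat (length ps) (length ps) (\<lambda>(i, j). (deriv ^^ i) (map poly ps ! j) x) =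
      Matrix.mat (length ps) (length ps) (\<lambda>(i, j). poly ((pderiv ^^ i) (ps ! j)) x)"
    by (rule eq_matI) (auto simp: funpow_deriv_poly)
  thus "wronskian (map poly ps) x = poly (wr_poly ps) x"
    by (simp add: wronskian_def poly_wr_poly)
qed

lemma power_dvd_if_derivs_0:
  fixes f :: "real poly"
  assumes "\<And>i. i < n \<Longrightarrow> poly ((pderiv ^^ i) f) a = 0"
  shows "[:-a, 1:] ^ n dvd f"
  using assms
proof (induction n arbitrary: f)
  case (Suc n)
  have f0: "poly f a = 0" using Suc.prems[of 0] by simp
  have "poly ((pderiv ^^ i) (pderiv f)) a = 0" if "i < n" for i
    using Suc.prems[of "Suc i"] that by (simp add: funpow_swap1)
  from Suc.IH[OF this] have d: "[:-a, 1:] ^ n dvd pderiv f" .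
  show ?case
  proof (cases "f = 0")
    case False
    have "pderiv f \<noteq> 0"
    proof
      assume "pderiv f = 0"
      then obtain c where "f = [:c:]" by (metis pderiv_eq_0_iff degree_eq_zeroE)
      thus False using f0 False by simp
    qed
    hence "n \<le> order a (pderiv f)" using d order_divides by blast
    thus ?thesis using order_pderiv[OF False f0] order_divides[of a "Suc n" f] by simp
  qed simp
qed simp

text \<open>
  A vector in the kernel of the singular Wronskian matrix at \<open>x0\<close> is the coefficient vector of a
  combination all of whose derivatives of order below the matrix size vanish at \<open>x0\<close>.
\<close>
lemma wr_poly_zero_imp_high_order:
  assumes "poly (wr_poly ps) x0 = 0"
  shows "\<exists>v. (\<exists>j<length ps. v j \<noteq> 0) \<and>
    [:-x0, 1:] ^ length ps dvd (\<Sum>j<length ps. Polynomial.smult (v j) (ps ! j))"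
proof -
  define n where "n = length ps"
  define A where "A = Matrix.mat n n (\<lambda>(i, j). poly ((pderiv ^^ i) (ps ! j)) x0)"
  have A: "A \<in> carrier_mat n n" by (simp add: A_def)
  have "Determinant.det A = 0" using assms by (simp add: poly_wr_poly A_def n_def)
  then obtain w where w: "w \<in> carrier_vec n" "w \<noteq> 0\<^sub>v n" "A *\<^sub>v w = 0\<^sub>v n"
    using det_0_iff_vec_prod_zero[OF A] by blast
  define v where "v = (\<lambda>j. vec_index w j)"
  have "\<exists>j<n. v j \<noteq> 0"
  proof (rule ccontr)
    assume "\<not> ?thesis"
    hence "w = 0\<^sub>v n" using w(1) by (intro eq_vecI) (auto simp: v_def)
    thus False using w(2) by simp
  qed
  moreover have "[:-x0, 1:] ^ n dvd (\<Sum>j<n. Polynomial.smult (v j) (ps ! j))"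
  proof (rule power_dvd_if_derivs_0)
    fix i assume i: "i < n"
    have "0 = vec_index (A *\<^sub>v w) i" using i w(3) by simp
    also have "\<dots> = (\<Sum>j<n. poly ((pderiv ^^ i) (ps ! j)) x0 * v j)"
      using i w(1) by (auto simp: A_def scalar_prod_def v_def lessThan_atLeast0 intro!: sum.cong)
    also have "\<dots> = poly ((pderiv ^^ i) (\<Sum>j<n. Polynomial.smult (v j) (ps ! j))) x0"
      by (simp add: higher_pderiv_sum higher_pderiv_smult poly_sum mult.commute)
    finally show "poly ((pderiv ^^ i) (\<Sum>j<n. Polynomial.smult (v j) (ps ! j))) x0 = 0" by simp
  qed
  ultimately show ?thesis unfolding n_def by blast
qed

text \<open>
  Laplace expansion along the last column exhibits \<open>y \<mapsto> Wr[ps, y]\<close> as a linear differential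
  operator whose leading coefficient is \<open>Wr[ps]\<close>.
\<close>
lemma wr_poly_append:
  obtains C where "\<And>y. wr_poly (ps @ [y]) = (\<Sum>i\<le>length ps. (pderiv ^^ i) y * C i)"
    and "C (length ps) = wr_poly ps"
proof
  define n where "n = length ps"
  \<comment> \<open>Deleting the last column removes \<open>y\<close>, so the cofactors may be taken with \<open>0\<close> in its place.\<close>
  define C where "C = (\<lambda>i. cofactor (wr_mat (ps @ [0])) i n)"
  have del: "mat_delete (wr_mat (ps @ [y])) i n = mat_delete (wr_mat (ps @ [0])) i n" for y i
    by (rule eq_matI) (auto simp: mat_delete_def wr_mat_def n_def nth_append)
  show "wr_poly (ps @ [y]) = (\<Sum>i\<le>length ps. (pderiv ^^ i) y * C i)" for y
  proof -
    have "wr_poly (ps @ [y]) = (\<Sum>i<Suc n. wr_mat (ps @ [y]) $$ (i, n) * cofactor (wr_mat (ps @ [y])) i n)"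
      unfolding wr_poly_def by (rule laplace_expansion_column) (auto simp: wr_mat_def n_def)
    also have "\<dots> = (\<Sum>i<Suc n. (pderiv ^^ i) y * C i)"
    proof (intro sum.cong refl)
      fix i assume "i \<in> {..<Suc n}"
      hence "wr_mat (ps @ [y]) $$ (i, n) = (pderiv ^^ i) y" by (simp add: wr_mat_def n_def)
      thus "wr_mat (ps @ [y]) $$ (i, n) * cofactor (wr_mat (ps @ [y])) i n = (pderiv ^^ i) y * C i"
        by (simp only: C_def cofactor_def del[of y])
    qed
    finally show ?thesis by (simp add: n_def lessThan_Suc_atMost)
  qed
  have "mat_delete (wr_mat (ps @ [0])) n n = wr_mat ps"
    by (rule eq_matI) (auto simp: mat_delete_def wr_mat_def n_def nth_append)
  thus "C (length ps) = wr_poly ps"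
    by (simp add: C_def cofactor_def wr_poly_def n_def[symmetric] power_add[symmetric] mult_2[symmetric])
qed

lemma wr_poly_repeated:
  assumes "j < length ps"
  shows "wr_poly (ps @ [ps ! j]) = 0"
  unfolding wr_poly_def
  by (rule det_identical_columns[OF wr_mat_carrier, of j "length ps"])
    (use assms in \<open>auto simp: wr_mat_def nth_append intro!: eq_vecI\<close>)

lemma pderiv_surj: "\<exists>u. pderiv u = p" for p :: "real poly"
proof -
  define u where "u = (\<Sum>i\<le>Polynomial.degree p. monom (Polynomial.coeff p i / of_nat (Suc i)) (Suc i))"
  have "pderiv u = (\<Sum>i\<le>Polynomial.degree p. monom (Polynomial.coeff p i) i)"
    unfolding u_def by (simp add: higher_pderiv_sum[of 1, simplified] pderiv_monom del: of_nat_Suc)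
  thus ?thesis by (metis poly_as_sum_of_monoms)
qed

text \<open>
  The functions \<open>u\<^sub>j\<close> are antiderivatives of \<open>q\<close> times the last column of the adjugate of the
  Wronskian matrix, so no division occurs and everything stays polynomial. As the matrix times its
  adjugate is the determinant times the identity, differentiating \<open>y = \<Sum> p\<^sub>j u\<^sub>j\<close> never produces
  derivatives of the \<open>u\<^sub>j\<close> until the last step, where they contribute \<open>Wr[ps] q\<close>.
\<close>
lemma variation_of_parameters:
  obtains y u where
    "\<And>i. i < length ps \<Longrightarrow> (pderiv ^^ i) y = (\<Sum>j<length ps. (pderiv ^^ i) (ps ! j) * u j)"
    "(pderiv ^^ length ps) y =
       (\<Sum>j<length ps. (pderiv ^^ length ps) (ps ! j) * u j) + wr_poly ps * q"
proof (cases "length ps = 0")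
  case True
  thus ?thesis by (intro that[of q "\<lambda>_. 0"]) (auto simp: wr_poly_def wr_mat_def)
next
  case False
  define n where "n = length ps"
  define A where "A = wr_mat ps"
  have A: "A \<in> carrier_mat n n" by (simp add: A_def n_def)
  have "\<forall>j. \<exists>u. pderiv u = adj_mat A $$ (j, n - 1) * q" using pderiv_surj by blast
  then obtain u where u: "\<And>j. pderiv (u j) = adj_mat A $$ (j, n - 1) * q" by metis
  have ortho: "(\<Sum>j<n. (pderiv ^^ i) (ps ! j) * pderiv (u j)) = (if i = n - 1 then wr_poly ps * q else 0)"
    if "i < n" for i
  proof -
    have "(\<Sum>j<n. (pderiv ^^ i) (ps ! j) * pderiv (u j)) =
        (\<Sum>j<n. A $$ (i, j) * adj_mat A $$ (j, n - 1)) * q"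
      using that by (simp add: u sum_distrib_right A_def wr_mat_def n_def mult.assoc)
    also have "(\<Sum>j<n. A $$ (i, j) * adj_mat A $$ (j, n - 1)) = (A * adj_mat A) $$ (i, n - 1)"
      using that A adj_mat(1)[OF A]
      by (auto simp: scalar_prod_def lessThan_atLeast0 intro!: sum.cong)
    also have "\<dots> = (if i = n - 1 then wr_poly ps else 0)"
      unfolding adj_mat(2)[OF A] using that by (auto simp: wr_poly_def A_def)
    finally show ?thesis by simp
  qed
  define y where "y = (\<Sum>j<n. ps ! j * u j)"
  have step: "pderiv (\<Sum>j<n. (pderiv ^^ i) (ps ! j) * u j) =
      (\<Sum>j<n. (pderiv ^^ Suc i) (ps ! j) * u j) + (if i = n - 1 then wr_poly ps * q else 0)" if "i < n" for i
  proof -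
    have "pderiv (\<Sum>j<n. (pderiv ^^ i) (ps ! j) * u j) =
        (\<Sum>j<n. (pderiv ^^ i) (ps ! j) * pderiv (u j)) + (\<Sum>j<n. (pderiv ^^ Suc i) (ps ! j) * u j)"
      by (simp add: higher_pderiv_sum[of 1, simplified] pderiv_mult sum.distrib mult.commute)
    thus ?thesis using ortho[OF that] by simp
  qed
  have low: "(pderiv ^^ i) y = (\<Sum>j<n. (pderiv ^^ i) (ps ! j) * u j)" if "i < n" for i
    using that
  proof (induction i)
    case 0
    show ?case by (simp add: y_def)
  next
    case (Suc i)
    thus ?case using step[of i] by simp
  qed
  obtain m where m: "n = Suc m" using False by (cases n) (auto simp: n_def)
  have "(pderiv ^^ n) y = (\<Sum>j<n. (pderiv ^^ n) (ps ! j) * u j) + wr_poly ps * q"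
    using low[of m] step[of m] by (simp add: m)
  thus ?thesis using low by (intro that[of y u]) (auto simp: n_def)
qed

text \<open>
  Applying the operator \<open>Wr[ps, \<cdot>]\<close> to the \<open>y\<close> of \<open>variation_of_parameters\<close>, the terms with \<open>u\<^sub>j\<close>
  reassemble to \<open>u\<^sub>j Wr[ps, p\<^sub>j] = 0\<close>, and only the leading coefficient times the extra term is left.
\<close>
lemma wr_poly_range:
  "\<exists>y. wr_poly (ps @ [y]) = wr_poly ps * wr_poly ps * q"
proof -
  define n where "n = length ps"
  obtain C where C: "\<And>y. wr_poly (ps @ [y]) = (\<Sum>i\<le>n. (pderiv ^^ i) y * C i)"
    and Cn: "C n = wr_poly ps"
    using wr_poly_append[of ps] unfolding n_def by blast
  obtain y u where y: "\<And>i. i < n \<Longrightarrow> (pderiv ^^ i) y = (\<Sum>j<n. (pderiv ^^ i) (ps ! j) * u j)"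
    "(pderiv ^^ n) y = (\<Sum>j<n. (pderiv ^^ n) (ps ! j) * u j) + wr_poly ps * q"
    using variation_of_parameters[of ps q] unfolding n_def by blast
  have y': "(pderiv ^^ i) y = (\<Sum>j<n. (pderiv ^^ i) (ps ! j) * u j) + (if i = n then wr_poly ps * q else 0)"
    if "i \<le> n" for i using y that by (cases "i = n") auto
  have "wr_poly (ps @ [y]) = (\<Sum>i\<le>n. ((\<Sum>j<n. (pderiv ^^ i) (ps ! j) * u j) +
      (if i = n then wr_poly ps * q else 0)) * C i)"
    unfolding C by (intro sum.cong refl) (use y' in auto)
  also have "\<dots> = (\<Sum>i\<le>n. \<Sum>j<n. (pderiv ^^ i) (ps ! j) * u j * C i) + wr_poly ps * q * C n"
    by (simp add: distrib_right sum.distrib sum_distrib_right if_distrib[of "\<lambda>t. t * _"] cong: if_cong)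
  also have "(\<Sum>i\<le>n. \<Sum>j<n. (pderiv ^^ i) (ps ! j) * u j * C i) = (\<Sum>j<n. u j * wr_poly (ps @ [ps ! j]))"
    unfolding C by (subst sum.swap) (simp add: sum_distrib_left ac_simps)
  also have "\<dots> = 0" by (intro sum.neutral) (simp add: wr_poly_repeated n_def)
  finally show ?thesis by (intro exI[of _ y]) (simp add: Cn ac_simps)
qed

lemma smult_sum_right: "Polynomial.smult a (\<Sum>i\<in>I. f i) = (\<Sum>i\<in>I. Polynomial.smult a (f i))"
  by (induction I rule: infinite_finite_induct) (simp_all add: smult_add_right)

lemma wr_poly_append_sum:
  "wr_poly (ps @ [\<Sum>n\<in>I. Polynomial.smult (c n) (f n)]) = (\<Sum>n\<in>I. Polynomial.smult (c n) (wr_poly (ps @ [f n])))"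
proof -
  obtain C where C: "\<And>y. wr_poly (ps @ [y]) = (\<Sum>i\<le>length ps. (pderiv ^^ i) y * C i)"
    using wr_poly_append[of ps] by blast
  have "(\<Sum>i\<le>length ps. (pderiv ^^ i) (\<Sum>n\<in>I. Polynomial.smult (c n) (f n)) * C i) =
     (\<Sum>i\<le>length ps. \<Sum>n\<in>I. Polynomial.smult (c n) ((pderiv ^^ i) (f n) * C i))"
    by (simp add: higher_pderiv_sum higher_pderiv_smult sum_distrib_right)
  also have "\<dots> = (\<Sum>n\<in>I. Polynomial.smult (c n) (\<Sum>i\<le>length ps. (pderiv ^^ i) (f n) * C i))"
    by (subst sum.swap) (simp add: smult_sum_right)
  finally show ?thesis unfolding C .
qed

section \<open>Wronskians of Hermite polynomials for even partitions\<close>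

text \<open>
  This keeps \<open>1 / H\<^sup>2\<close> bounded, so that \<open>w / H\<^sup>2\<close> has all moments, as \<open>w\<close> does.
\<close>
lemma poly_bounded_below:
  fixes p :: "real poly"
  assumes nz: "\<And>x. poly p x \<noteq> 0"
  shows "\<exists>d>0. \<forall>x. d \<le> \<bar>poly p x\<bar>"
proof (cases p)
  case (pCons a q)
  show ?thesis
  proof (cases "q = 0")
    case True
    hence "\<bar>poly p x\<bar> = \<bar>a\<bar>" "a \<noteq> 0" for x using nz[of 0] by (auto simp: pCons)
    thus ?thesis by (intro exI[of _ "\<bar>a\<bar>"]) auto
  next
    case False
    obtain r where r: "\<And>x. r \<le> \<bar>x\<bar> \<Longrightarrow> 1 \<le> \<bar>poly p x\<bar>"
      using poly_infinity[OF False, of 1 a] unfolding pCons by auto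
    have "\<exists>x\<in>{-\<bar>r\<bar>..\<bar>r\<bar>}. \<forall>y\<in>{-\<bar>r\<bar>..\<bar>r\<bar>}. \<bar>poly p x\<bar> \<le> \<bar>poly p y\<bar>"
      by (intro continuous_attains_inf continuous_intros) auto
    then obtain x where x: "\<forall>y\<in>{-\<bar>r\<bar>..\<bar>r\<bar>}. \<bar>poly p x\<bar> \<le> \<bar>poly p y\<bar>"
      by blast
    have "min 1 \<bar>poly p x\<bar> \<le> \<bar>poly p y\<bar>" for y
    proof (cases "\<bar>y\<bar> \<le> \<bar>r\<bar>")
      case True
      hence "y \<in> {-\<bar>r\<bar>..\<bar>r\<bar>}" by auto
      hence "\<bar>poly p x\<bar> \<le> \<bar>poly p y\<bar>" using x by blast
      thus ?thesis by simp
    next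
      case False
      hence "r \<le> \<bar>y\<bar>" by linarith
      from r[OF this] show ?thesis by simp
    qed
    thus ?thesis using nz[of x] by (intro exI[of _ "min 1 \<bar>poly p x\<bar>"]) auto
  qed
qed

lemma length_part_indices [simp]: "length (part_indices l) = length l"
  by (simp add: part_indices_def)

lemma nth_part_indices: "i < length l \<Longrightarrow> part_indices l ! i = l ! i + (length l - (i + 1))"
  by (simp add: part_indices_def)

lemma distinct_part_indices:
  assumes "is_partition l"
  shows "distinct (part_indices l)"
proof -
  have "part_indices l ! j < part_indices l ! i" if "i < j" "j < length l" for i j
  proof -
    have "l ! j \<le> l ! i" using assms that by (auto simp: is_partition_def sorted_wrt_iff_nth_less)
    thus ?thesis using that by (simp add: nth_part_indices)
  qed
  thus ?thesis unfolding distinct_conv_nth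
    by (metis length_part_indices linorder_neqE_nat nat_neq_iff)
qed

text \<open>
  Equal neighbours \<open>\<lambda>\<^sub>2\<^sub>i\<^sub>-\<^sub>1 = \<lambda>\<^sub>2\<^sub>i\<close> give consecutive indices \<open>k\<^sub>2\<^sub>i\<^sub>-\<^sub>1 = k\<^sub>2\<^sub>i + 1\<close>. The list \<open>as\<close> collects
  the smaller member of each pair.
\<close>
lemma K_set_pairs:
  assumes "even_partition l"
  obtains as where "length l = 2 * length as" "K_set l = set as \<union> Suc ` set as"
proof -
  obtain m where m: "length l = 2 * m" "\<And>i. i < m \<Longrightarrow> l ! (2 * i) = l ! (2 * i + 1)"
    using assms by (auto simp: even_partition_def)
  define as where "as = map (\<lambda>i. part_indices l ! (2 * i + 1)) [0..<m]"
  have pair: "part_indices l ! (2 * i) = Suc (part_indices l ! (2 * i + 1))" if "i < m" for i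
    using that m by (simp add: nth_part_indices)
  have "K_set l = (\<lambda>i. part_indices l ! i) ` {..<2 * m}"
    using m(1) by (auto simp: set_conv_nth)
  also have "{..<2 * m} = (\<lambda>i. 2 * i + 1) ` {..<m} \<union> (\<lambda>i. 2 * i) ` {..<m}"
  proof safe
    fix i assume "i < 2 * m" "i \<notin> (\<lambda>i. 2 * i) ` {..<m}"
    thus "i \<in> (\<lambda>i. 2 * i + 1) ` {..<m}"
      by (cases "even i") (auto elim!: evenE oddE)
  qed auto
  also have "(\<lambda>i. part_indices l ! i) ` \<dots> = set as \<union> Suc ` set as"
    using pair by (auto simp: as_def image_Un image_image lessThan_atLeast0)
  finally show ?thesis using m(1) by (intro that[of as]) (simp_all add: as_def)
qed

definition herm_list :: "nat list \<Rightarrow> real poly list" where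
  "herm_list l = map hermite_poly (rev (part_indices l))"

lemma hermite_part_eq: "hermite_part l = poly (wr_poly (herm_list l))"
proof -
  have "map hermite ks = map poly (map hermite_poly ks)" for ks by (simp add: hermite_eq_poly)
  thus ?thesis by (simp add: hermite_part_def herm_list_def wronskian_eq_poly del: map_map)
qed

lemma exc_hermite_eq: "exc_hermite l n = poly (wr_poly (herm_list l @ [hermite_poly n]))"
proof -
  have "map hermite ks = map poly (map hermite_poly ks)" for ks by (simp add: hermite_eq_poly)
  thus ?thesis
    by (simp add: exc_hermite_def herm_list_def wronskian_eq_poly[symmetric] hermite_eq_poly[of n] del: map_map)
qed

text \<open>
  The direction of the Krein--Adler theorem that makes the weight regular.
\<close>
theorem hermite_part_no_zeros:
  assumes "even_partition l"
  shows "hermite_part l x0 \<noteq> 0"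
proof
  assume "hermite_part l x0 = 0"
  hence "poly (wr_poly (herm_list l)) x0 = 0" by (simp add: hermite_part_eq)
  then obtain v where v: "\<exists>j<length l. v j \<noteq> 0"
      "[:-x0, 1:] ^ length l dvd (\<Sum>j<length l. Polynomial.smult (v j) (herm_list l ! j))"
    using wr_poly_zero_imp_high_order[of "herm_list l" x0] by (auto simp: herm_list_def)
  obtain as where as: "length l = 2 * length as" "K_set l = set as \<union> Suc ` set as"
    by (rule K_set_pairs[OF assms])
  define ks where "ks = rev (part_indices l)"
  have ks: "distinct ks" "length ks = length l" "set ks = K_set l"
    using distinct_part_indices assms by (auto simp: ks_def even_partition_def)
  have bij: "bij_betw (\<lambda>j. ks ! j) {..<length l} (K_set l)"
    using bij_betw_nth[OF ks(1), of "{..<length l}" "K_set l"] ks by simp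
  define w where "w = (\<lambda>k. v (the_inv_into {..<length l} (\<lambda>j. ks ! j) k))"
  have w: "w (ks ! j) = v j" if "j < length l" for j
    using that bij by (simp add: w_def the_inv_into_f_f bij_betw_def)
  have "(\<Sum>k\<in>K_set l. Polynomial.smult (w k) (hermite_poly k)) =
      (\<Sum>j<length l. Polynomial.smult (w (ks ! j)) (hermite_poly (ks ! j)))"
    by (rule sum.reindex_bij_betw[OF bij, symmetric])
  also have "\<dots> = (\<Sum>j<length l. Polynomial.smult (v j) (herm_list l ! j))"
    by (intro sum.cong refl) (simp add: w herm_list_def ks(2) flip: ks_def)
  finally have d: "[:-x0, 1:] ^ (2 * length as) dvd (\<Sum>k\<in>K_set l. Polynomial.smult (w k) (hermite_poly k))"
    using v(2) as(1) by simp
  obtain j where j: "j < length l" "v j \<noteq> 0" using v(1) by blast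
  have "ks ! j \<in> K_set l" using j(1) ks nth_mem by metis
  from hermite_span_no_high_order_zero[OF d as(2) this] w[OF j(1)] j(2) show False by simp
qed

lemma sum_fun_eval: "(\<Sum>i\<in>I. f i) = (\<lambda>x. \<Sum>i\<in>I. f i x)" for f :: "'i \<Rightarrow> 'a \<Rightarrow> complex"
  by (induction I rule: infinite_finite_induct) (auto simp: fun_eq_iff)

text \<open>
  Expand the polynomial \<open>y\<close> of \<open>wr_poly_range\<close> in Hermite polynomials. The terms with index in
  \<open>K_set l\<close>, which are not generators of the span, vanish since they repeat a column of the
  Wronskian.
\<close>
lemma ideal_subset_exc_space:
  fixes q :: "real poly"
  shows "(\<lambda>x. complex_of_real (poly (wr_poly (herm_list l) * wr_poly (herm_list l) * q) x)) \<in> exc_space l"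
proof -
  let ?ps = "herm_list l"
  obtain y where y: "wr_poly (?ps @ [y]) = wr_poly ?ps * wr_poly ?ps * q"
    using wr_poly_range by blast
  obtain c where c: "y = (\<Sum>n\<le>Polynomial.degree y. Polynomial.smult (c n) (hermite_poly n))"
    using hermite_poly_expansion[OF order_refl] by blast
  let ?N = "Polynomial.degree y"
  let ?h = "\<lambda>n x. complex_of_real (exc_hermite l n x)"
  have zero: "exc_hermite l n x = 0" if "n \<in> K_set l" for n x
  proof -
    have "n \<in> set (rev (part_indices l))" using that by simp
    then obtain j where "j < length (rev (part_indices l))" "rev (part_indices l) ! j = n"
      by (metis in_set_conv_nth)
    hence "j < length ?ps" "?ps ! j = hermite_poly n" by (auto simp: herm_list_def)
    thus ?thesis using wr_poly_repeated[of j ?ps] by (simp add: exc_hermite_eq)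
  qed
  have "(\<lambda>x. complex_of_real (poly (wr_poly ?ps * wr_poly ?ps * q) x)) =
      (\<lambda>x. \<Sum>n\<le>?N. complex_of_real (c n) * ?h n x)"
  proof
    fix x
    have "wr_poly ?ps * wr_poly ?ps * q =
        (\<Sum>n\<le>?N. Polynomial.smult (c n) (wr_poly (?ps @ [hermite_poly n])))"
      unfolding y[symmetric] wr_poly_append_sum[symmetric] c[symmetric] ..
    thus "complex_of_real (poly (wr_poly ?ps * wr_poly ?ps * q) x) = (\<Sum>n\<le>?N. complex_of_real (c n) * ?h n x)"
      by (simp only: poly_sum poly_smult exc_hermite_eq of_real_sum of_real_mult)
  qed
  also have "\<dots> = (\<lambda>x. \<Sum>n\<in>{..?N} - K_set l. complex_of_real (c n) * ?h n x)"
    by (rule ext, rule sum.mono_neutral_right) (auto simp: zero)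
  also have "\<dots> = (\<Sum>n\<in>{..?N} - K_set l. fun_scale (complex_of_real (c n)) (?h n))"
    by (simp add: sum_fun_eval fun_scale_def)
  also have "\<dots> \<in> exc_space l"
    unfolding exc_space_def
    by (intro complex_fun.span_sum complex_fun.span_scale complex_fun.span_base) auto
  finally show ?thesis .
qed

section \<open>Density in the weighted space\<close>

lemma subspace_space_L2: "complex_fun.subspace (space_L2 M)"
proof (rule complex_fun.subspaceI)
  show "0 \<in> space_L2 M" by (simp add: space_L2_def zero_fun_def)
next
  fix f g assume f: "f \<in> space_L2 M" and g: "g \<in> space_L2 M"
  have [measurable]: "f \<in> borel_measurable M" "g \<in> borel_measurable M"
    using f g by (auto simp: space_L2_def)
  have i: "integrable M (\<lambda>x. 2 * (cmod (f x))\<^sup>2 + 2 * (cmod (g x))\<^sup>2)"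
    using f g by (auto simp: space_L2_def)
  have "(cmod (f x + g x))\<^sup>2 \<le> 2 * (cmod (f x))\<^sup>2 + 2 * (cmod (g x))\<^sup>2" for x
  proof -
    have "(cmod (f x + g x))\<^sup>2 \<le> (cmod (f x) + cmod (g x))\<^sup>2"
      by (intro power_mono norm_triangle_ineq) auto
    also have "\<dots> \<le> 2 * (cmod (f x))\<^sup>2 + 2 * (cmod (g x))\<^sup>2"
      using zero_le_power2[of "cmod (f x) - cmod (g x)"] unfolding power2_sum power2_diff by linarith
    finally show ?thesis .
  qed
  hence "integrable M (\<lambda>x. (cmod (f x + g x))\<^sup>2)"
    by (intro Bochner_Integration.integrable_bound[OF i]) auto
  thus "f + g \<in> space_L2 M" by (simp add: space_L2_def plus_fun_def)
next
  fix c f assume f: "f \<in> space_L2 M"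
  thus "fun_scale c f \<in> space_L2 M"
    by (auto simp: space_L2_def fun_scale_def norm_mult power_mult_distrib)
qed

lemma exc_weight_eq:
  "exc_weight l = density lborel (\<lambda>x. ennreal (exp (- x\<^sup>2) / (poly (wr_poly (herm_list l)) x)\<^sup>2))"
  by (simp add: exc_weight_def hermite_part_eq)

lemma sets_exc_weight [measurable_cong, simp]: "sets (exc_weight l) = sets borel"
  by (simp add: exc_weight_def)

lemma integrable_exc_weight_iff:
  fixes f :: "real \<Rightarrow> real"
  assumes [measurable]: "f \<in> borel_measurable borel"
  shows "integrable (exc_weight l) f \<longleftrightarrow>
    integrable lborel (\<lambda>x. exp (- x\<^sup>2) / (poly (wr_poly (herm_list l)) x)\<^sup>2 * f x)"
  unfolding exc_weight_eq by (subst integrable_density) auto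

lemma integral_exc_weight:
  fixes f :: "real \<Rightarrow> real"
  assumes [measurable]: "f \<in> borel_measurable borel"
  shows "(\<integral>x. f x \<partial>exc_weight l) =
    (\<integral>x. exp (- x\<^sup>2) / (poly (wr_poly (herm_list l)) x)\<^sup>2 * f x \<partial>lborel)"
  unfolding exc_weight_eq by (subst integral_density) auto

lemma poly_in_space_L2:
  assumes "even_partition l"
  shows "(\<lambda>x. complex_of_real (poly p x)) \<in> space_L2 (exc_weight l)"
proof -
  let ?H = "wr_poly (herm_list l)"
  obtain d where d: "d > 0" "\<And>x. d \<le> \<bar>poly ?H x\<bar>"
    using poly_bounded_below[of ?H] hermite_part_no_zeros[OF assms] by (auto simp: hermite_part_eq)
  have i: "integrable lborel (\<lambda>x. inverse (d\<^sup>2) * (poly (p * p) x * exp (0 * \<bar>x\<bar>) * exp (- x\<^sup>2)))"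
    by (intro integrable_mult_right integrable_poly_exp_gauss)
  have "integrable lborel (\<lambda>x. exp (- x\<^sup>2) / (poly ?H x)\<^sup>2 * (poly p x)\<^sup>2)"
  proof (rule Bochner_Integration.integrable_bound[OF i])
    have "exp (- x\<^sup>2) / (poly ?H x)\<^sup>2 * (poly p x)\<^sup>2 \<le> inverse (d\<^sup>2) * (poly p x * poly p x * exp (- x\<^sup>2))" for x
    proof -
      have "d\<^sup>2 \<le> (poly ?H x)\<^sup>2" using d power_mono[of d "\<bar>poly ?H x\<bar>" 2] by simp
      hence "inverse ((poly ?H x)\<^sup>2) \<le> inverse (d\<^sup>2)" using d(1) by (intro le_imp_inverse_le) auto
      hence "inverse ((poly ?H x)\<^sup>2) * ((poly p x)\<^sup>2 * exp (- x\<^sup>2)) \<le> inverse (d\<^sup>2) * ((poly p x)\<^sup>2 * exp (- x\<^sup>2))"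
        by (intro mult_right_mono) auto
      thus ?thesis by (simp add: divide_inverse power2_eq_square ac_simps)
    qed
    thus "AE x in lborel. norm (exp (- x\<^sup>2) / (poly ?H x)\<^sup>2 * (poly p x)\<^sup>2) \<le>
        norm (inverse (d\<^sup>2) * (poly (p * p) x * exp (0 * \<bar>x\<bar>) * exp (- x\<^sup>2)))"
      by (auto simp: abs_mult)
  qed measurable
  hence "integrable (exc_weight l) (\<lambda>x. (poly p x)\<^sup>2)" by (subst integrable_exc_weight_iff) auto
  thus ?thesis by (simp add: space_L2_def)
qed

theorem theorem2p1:
  fixes l :: "nat list"
  assumes "even_partition l"
  shows "dense_L2 (exc_weight l) (exc_space l)"
proof -
  define H where "H = wr_poly (herm_list l)"
  have H0: "poly H x \<noteq> 0" for x
    using hermite_part_no_zeros[OF assms] by (simp add: H_def hermite_part_eq)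
  interpret M: exponential_moments "poly_gauss H" by (rule exponential_moments_poly_gauss)
  have sub: "exc_space l \<subseteq> space_L2 (exc_weight l)"
    unfolding exc_space_def
    by (rule complex_fun.span_minimal[OF _ subspace_space_L2])
      (auto simp: exc_hermite_eq intro: poly_in_space_L2[OF assms])
  have approx: "\<exists>p. integrable (exc_weight l) (\<lambda>x. (f x - poly (H * H * p) x)\<^sup>2) \<and>
      (\<integral>x. (f x - poly (H * H * p) x)\<^sup>2 \<partial>exc_weight l) < e"
    if [measurable]: "f \<in> borel_measurable borel" and f: "integrable (exc_weight l) (\<lambda>x. (f x)\<^sup>2)" and "e > 0"
    for f :: "real \<Rightarrow> real" and e
  proof -
    define F where "F = (\<lambda>x. f x / (poly H x)\<^sup>2)"
    have [measurable]: "F \<in> borel_measurable borel" unfolding F_def by measurable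
    \<comment> \<open>Division by \<open>H\<^sup>2\<close> is an isometry from the given weight to \<open>H\<^sup>2 w\<close>.\<close>
    have scale: "exp (- x\<^sup>2) / (poly H x)\<^sup>2 * (f x - poly (H * H * p) x)\<^sup>2 =
        (poly H x)\<^sup>2 * exp (- x\<^sup>2) * (F x - poly p x)\<^sup>2" for x p
    proof -
      have "f x - poly (H * H * p) x = (poly H x)\<^sup>2 * (F x - poly p x)"
        using H0[of x] by (simp add: F_def power2_eq_square field_simps)
      thus ?thesis using H0[of x] by (simp add: power_mult_distrib power2_eq_square)
    qed
    have "integrable (poly_gauss H) (\<lambda>x. (F x)\<^sup>2)"
      using f scale[of _ 0] by (simp add: integrable_exc_weight_iff integrable_poly_gauss_iff H_def)
    then obtain p where p: "integrable (poly_gauss H) (\<lambda>x. (F x - poly p x)\<^sup>2)"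
        "(\<integral>x. (F x - poly p x)\<^sup>2 \<partial>poly_gauss H) < e"
      using M.poly_approx_L2[of F] \<open>e > 0\<close> unfolding M.poly_approx_def by auto
    have "integrable lborel (\<lambda>x. (poly H x)\<^sup>2 * exp (- x\<^sup>2) * (F x - poly p x)\<^sup>2)"
      using p(1) by (subst (asm) integrable_poly_gauss_iff) simp_all
    hence "integrable (exc_weight l) (\<lambda>x. (f x - poly (H * H * p) x)\<^sup>2)"
      by (subst integrable_exc_weight_iff) (simp_all only: H_def[symmetric] scale, measurable)
    moreover have "(\<integral>x. (f x - poly (H * H * p) x)\<^sup>2 \<partial>exc_weight l) =
        (\<integral>x. (F x - poly p x)\<^sup>2 \<partial>poly_gauss H)"
      by (subst integral_exc_weight, measurable, subst integral_poly_gauss, measurable)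
        (simp only: H_def[symmetric] scale)
    ultimately show ?thesis using p(2) by auto
  qed
  show ?thesis unfolding dense_L2_def
  proof (intro conjI ballI allI impI sub)
    fix f :: "real \<Rightarrow> complex" and e :: real
    assume f: "f \<in> space_L2 (exc_weight l)" and e: "e > 0"
    have [measurable]: "f \<in> borel_measurable borel" and fi: "integrable (exc_weight l) (\<lambda>x. (cmod (f x))\<^sup>2)"
      using f by (auto simp: space_L2_def cong: measurable_cong_sets)
    have "integrable (exc_weight l) (\<lambda>x. (Re (f x))\<^sup>2)" "integrable (exc_weight l) (\<lambda>x. (Im (f x))\<^sup>2)"
      by (rule Bochner_Integration.integrable_bound[OF fi]; simp add: cmod_power2)+
    moreover have "e\<^sup>2 / 2 > 0" using e by simp
    ultimately obtain p1 p2 where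
      p1: "integrable (exc_weight l) (\<lambda>x. (Re (f x) - poly (H * H * p1) x)\<^sup>2)"
        "(\<integral>x. (Re (f x) - poly (H * H * p1) x)\<^sup>2 \<partial>exc_weight l) < e\<^sup>2 / 2" and
      p2: "integrable (exc_weight l) (\<lambda>x. (Im (f x) - poly (H * H * p2) x)\<^sup>2)"
        "(\<integral>x. (Im (f x) - poly (H * H * p2) x)\<^sup>2 \<partial>exc_weight l) < e\<^sup>2 / 2"
      using approx[of "\<lambda>x. Re (f x)" "e\<^sup>2 / 2"] approx[of "\<lambda>x. Im (f x)" "e\<^sup>2 / 2"] by auto
    let ?c = "\<lambda>p x. complex_of_real (poly (H * H * p) x)"
    define g where "g = ?c p1 + fun_scale \<i> (?c p2)"
    have "g \<in> exc_space l"
      using ideal_subset_exc_space[of l p1] ideal_subset_exc_space[of l p2]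
      unfolding g_def exc_space_def H_def
      by (intro complex_fun.span_add complex_fun.span_scale)
    moreover have "norm_L2 (exc_weight l) (\<lambda>x. f x - g x) < e"
    proof -
      have "(cmod (f x - g x))\<^sup>2 = (Re (f x) - poly (H * H * p1) x)\<^sup>2 + (Im (f x) - poly (H * H * p2) x)\<^sup>2" for x
        by (simp add: cmod_power2 g_def fun_scale_def)
      hence "(\<integral>x. (cmod (f x - g x))\<^sup>2 \<partial>exc_weight l) =
          (\<integral>x. (Re (f x) - poly (H * H * p1) x)\<^sup>2 \<partial>exc_weight l) +
          (\<integral>x. (Im (f x) - poly (H * H * p2) x)\<^sup>2 \<partial>exc_weight l)"
        by (simp only: Bochner_Integration.integral_add[OF p1(1) p2(1)])
      also have "\<dots> < e\<^sup>2" using p1(2) p2(2) by linarith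
      finally have "norm_L2 (exc_weight l) (\<lambda>x. f x - g x) < sqrt (e\<^sup>2)"
        unfolding norm_L2_def by (intro real_sqrt_less_mono)
      thus ?thesis using e by simp
    qed
    ultimately show "\<exists>g\<in>exc_space l. norm_L2 (exc_weight l) (\<lambda>x. f x - g x) < e" by blast
  qed
qed

end
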